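(* Let $\mathbb{A}$ be a finite-dimensional (associative unital) algebra over a field $\mathbb{F}$ and let $n\in\mathbb{N}$. Then the ring $\mathbb{A}[x_1,\dots,x_n]$ is strongly left Jacobson. Moreover, every maximal left ideal of $\mathbb{A}[x_1,\dots,x_n]$ has finite codimension over $\mathbb{F}$.
   Context: All rings and algebras are associative and unital. $\mathbb{A}[x_1,\dots,x_n]:=\mathbb{A}\otimes_{\mathbb{F}}\mathbb{F}[x_1,\dots,x_n]$ is the algebra of polynomials with coefficients in $\mathbb{A}$ in central (commuting) variables $x_1,\dots,x_n$. A left ideal $I$ of a ring $B$ is semiprime if for every $a\in B$ with $aBa\subseteq I$ we have $a\in I$. A ring is strongly left Jacobson if every semiprime left ideal is an intersection of maximal left ideals (the empty intersection being the whole ring). *)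

theory Defs
  imports Complex_Main "HOL-Library.Poly_Mapping"
begin

text \<open>
  The class \<open>ring_1\<close> contains the axiom \<open>0 \<noteq> 1\<close>. In order not to exclude the zero algebra, the
  algebra is a type of class \<open>ring\<close> and the existence of a unit is an assumption.
\<close>

locale unital_algebra = vector_space scale
  for scale :: "'f::field \<Rightarrow> 'a::ring \<Rightarrow> 'a" (infixr \<open>*s\<close> 75) +
  assumes scale_mult_left: "c *s (x * y) = (c *s x) * y"
    and scale_mult_right: "c *s (x * y) = x * (c *s y)"
    and ex_unit: "\<exists>u::'a. \<forall>x. u * x = x \<and> x * u = x"

locale finite_dimensional_algebra = unital_algebra scale
  for scale :: "'f::field \<Rightarrow> 'a::ring \<Rightarrow> 'a" +
  assumes finite_dimensional: "\<exists>Basis. finite_dimensional_vector_space scale Basis"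

text \<open>
  A monomial is an exponent vector of type \<open>nat \<Rightarrow>\<^sub>0 nat\<close>, and the multiplication of
  \<open>(nat \<Rightarrow>\<^sub>0 nat) \<Rightarrow>\<^sub>0 'a\<close> is convolution: \<open>(a x\<^sup>\<alpha>) (b x\<^sup>\<beta>) = (a b) x\<^sup>\<alpha>\<^sup>+\<^sup>\<beta>\<close>, so the variables are
  central while the coefficients need not commute. The polynomials in \<open>n\<close> variables are those
  in which only variables with index in \<open>{..<n}\<close> occur.
\<close>

definition poly_ring :: "nat \<Rightarrow> ((nat \<Rightarrow>\<^sub>0 nat) \<Rightarrow>\<^sub>0 'a::ring) set" where
  "poly_ring n = {p. \<forall>m\<in>Poly_Mapping.keys p. Poly_Mapping.keys m \<subseteq> {..<n}}"

definition poly_scale ::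
    "('f \<Rightarrow> 'a \<Rightarrow> 'a) \<Rightarrow> 'f \<Rightarrow> ((nat \<Rightarrow>\<^sub>0 nat) \<Rightarrow>\<^sub>0 'a::ring) \<Rightarrow> ((nat \<Rightarrow>\<^sub>0 nat) \<Rightarrow>\<^sub>0 'a)" where
  "poly_scale scale c = Poly_Mapping.map (scale c)"

text \<open>
  The following notions refer to the ring with carrier \<open>B\<close> and the operations of the ambient type.
\<close>

definition left_ideal :: "'r::ring set \<Rightarrow> 'r set \<Rightarrow> bool" where
  "left_ideal B I \<longleftrightarrow> I \<subseteq> B \<and> 0 \<in> I \<and> (\<forall>x\<in>I. \<forall>y\<in>I. x - y \<in> I) \<and> (\<forall>b\<in>B. \<forall>x\<in>I. b * x \<in> I)"

definition semiprime_left_ideal :: "'r::ring set \<Rightarrow> 'r set \<Rightarrow> bool" where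
  "semiprime_left_ideal B I \<longleftrightarrow>
     left_ideal B I \<and> (\<forall>a\<in>B. (\<lambda>b. a * b * a) ` B \<subseteq> I \<longrightarrow> a \<in> I)"

definition maximal_left_ideal :: "'r::ring set \<Rightarrow> 'r set \<Rightarrow> bool" where
  "maximal_left_ideal B M \<longleftrightarrow>
     left_ideal B M \<and> M \<noteq> B \<and> (\<forall>J. left_ideal B J \<and> M \<subseteq> J \<longrightarrow> J = M \<or> J = B)"

text \<open>The intersection with \<open>B\<close> makes the empty family intersect to the whole ring.\<close>

definition strongly_left_Jacobson :: "'r::ring set \<Rightarrow> bool" where
  "strongly_left_Jacobson B \<longleftrightarrow>
     (\<forall>I. semiprime_left_ideal B I \<longrightarrow> (\<exists>\<M>. (\<forall>M\<in>\<M>. maximal_left_ideal B M) \<and> I = B \<inter> \<Inter>\<M>))"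

text \<open>The quotient space \<open>V / W\<close> is spanned by the cosets of finitely many elements of \<open>V\<close>.\<close>

definition finite_codimension ::
    "('f::field \<Rightarrow> 'v::ab_group_add \<Rightarrow> 'v) \<Rightarrow> 'v set \<Rightarrow> 'v set \<Rightarrow> bool" where
  "finite_codimension scale V W \<longleftrightarrow>
     (\<exists>S. finite S \<and> S \<subseteq> V \<and> (\<forall>v\<in>V. \<exists>s\<in>module.span scale S. v - s \<in> W))"

lemma zero_in_poly_ring: "0 \<in> poly_ring n"
  by (simp add: poly_ring_def)

lemma diff_in_poly_ring: "p \<in> poly_ring n \<Longrightarrow> q \<in> poly_ring n \<Longrightarrow> p - q \<in> poly_ring n"
proof -
  assume "p \<in> poly_ring n" "q \<in> poly_ring n"
  moreover have "Poly_Mapping.keys (p - q) \<subseteq> Poly_Mapping.keys p \<union> Poly_Mapping.keys q"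
    by (auto simp: in_keys_iff lookup_minus)
  ultimately show ?thesis
    unfolding poly_ring_def by blast
qed

lemma mult_in_poly_ring:
  assumes "p \<in> poly_ring n" "q \<in> poly_ring n"
  shows "p * q \<in> poly_ring n"
proof -
  have "Poly_Mapping.keys m \<subseteq> {..<n}" if "m \<in> Poly_Mapping.keys (p * q)" for m
  proof -
    obtain a b where "m = a + b" "a \<in> Poly_Mapping.keys p" "b \<in> Poly_Mapping.keys q"
      using \<open>m \<in> Poly_Mapping.keys (p * q)\<close> keys_mult[of p q] by blast
    then show ?thesis
      using assms keys_add[of a b] unfolding poly_ring_def by blast
  qed
  then show ?thesis by (simp add: poly_ring_def)
qed

context unital_algebra
begin

lemma lookup_poly_scale: "Poly_Mapping.lookup (poly_scale scale c p) m = c *s Poly_Mapping.lookup p m"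
  by (simp add: poly_scale_def map.rep_eq when_def)

lemma poly_scale_in_poly_ring: "p \<in> poly_ring n \<Longrightarrow> poly_scale scale c p \<in> poly_ring n"
  by (auto simp: poly_ring_def in_keys_iff lookup_poly_scale)

lemma vector_space_poly_scale: "vector_space (poly_scale scale)"
  by standard (auto intro!: poly_mapping_eqI
      simp: lookup_poly_scale lookup_add scale_right_distrib scale_left_distrib)

lemma ex_unit_poly_ring:
  "\<exists>u\<in>poly_ring n. \<forall>p :: (nat \<Rightarrow>\<^sub>0 nat) \<Rightarrow>\<^sub>0 'a. u * p = p \<and> p * u = p"
proof -
  obtain u :: 'a where u: "\<And>x. u * x = x" "\<And>x. x * u = x"
    using ex_unit by metis
  let ?u = "Poly_Mapping.single (0 :: nat \<Rightarrow>\<^sub>0 nat) u"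
  have "?u * p = p \<and> p * ?u = p" for p :: "(nat \<Rightarrow>\<^sub>0 nat) \<Rightarrow>\<^sub>0 'a"
  proof (induction p rule: update_induct)
    case const
    show ?case by simp
  next
    case (update f k v)
    have "Poly_Mapping.update k v f = f + Poly_Mapping.single k v"
      using update(1) by (intro poly_mapping_eqI)
        (auto simp: lookup_update lookup_add lookup_single when_def in_keys_iff)
    then show ?case
      using update(3) by (simp add: distrib_left distrib_right mult_single u)
  qed
  moreover have "?u \<in> poly_ring n"
    by (simp add: poly_ring_def)
  ultimately show ?thesis by blast
qed

end

end

theory Submission
  imports Defs "HOL-Computational_Algebra.Polynomial"
begin

text \<open>
  Write \<open>B = A[x\<^sub>1,\<dots>,x\<^sub>n]\<close>; it is generated by finitely many elements as a module over the central
  subring \<open>C\<close> of polynomials with scalar coefficients. Let \<open>I\<close> be a semiprime left ideal and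
  \<open>a \<notin> I\<close>. Enlarging \<open>I\<close> by Zorn's lemma we may assume that \<open>p = {z \<in> C. z a \<in> I}\<close> is prime and that
  elements of \<open>C - p\<close> are cancellable modulo \<open>I\<close>. Localizing at \<open>p\<close> (in the form of saturated left
  ideals) gives finite length, so some multiple \<open>a' = c a\<close> generates a simple module modulo \<open>I\<close>,
  with bimodule annihilator \<open>Q\<close>, and \<open>B / Q\<close> is semisimple, being embedded in a finite power of
  that module. If \<open>z a' = i + q\<close> with \<open>z \<in> C - p\<close>, \<open>i \<in> I\<close>, \<open>q \<in> Q\<close>, then \<open>q B q \<subseteq> I\<close>, so
  \<open>q \<in> I\<close> and \<open>a' \<in> I\<close>, a contradiction. So semisimplicity provides a left ideal \<open>M \<supseteq> I + Q\<close> without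
  elements of \<open>C - p\<close> such that \<open>M + B a'\<close> contains some \<open>z \<in> C - p\<close>. By the Nullstellensatz there
  is a proper ideal \<open>m \<supseteq> p\<close> of \<open>C\<close> of finite codimension modulo which \<open>z\<close> is a unit. By Nakayama's lemma
  \<open>M + m B\<close> is proper, and a maximal left ideal above it cannot contain \<open>a\<close>. The same two lemmas
  show that a maximal left ideal contains \<open>m B\<close> for some such \<open>m\<close>.
\<close>

section \<open>Nullstellensatz for polynomial rings\<close>

text \<open>Semiprimeness constrains only the sets \<open>x B x\<close>, while \<open>B / I\<close>
  is a mere module; it does not directly say that this module becomes semisimple after localization.
  The bimodule annihilator \<open>Q\<close> is the bridge: it makes a semisimple ring act on the
  submodule of interest, and semiprimeness is used only once, to see that replacing \<open>I\<close>
  by \<open>I + Q\<close> does not swallow \<open>a'\<close>.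

  A left ideal that is maximal after localization at \<open>p\<close> is in general far from maximal
  in \<open>B\<close>. The relation \<open>z - b * a' \<in> M\<close> with \<open>z\<close> outside
  \<open>p\<close> records that \<open>M + B a'\<close> is everything after localization. To carry
  this relation over to a genuine maximal left ideal, \<open>z\<close> has to stay invertible,
  whichever denominator it happens to be. This dictates the form of the Nullstellensatz: for each
  given \<open>z\<close> outside \<open>p\<close> an ideal above \<open>p\<close> modulo which
  \<open>z\<close> is a unit.

  Localized rings, quotient modules and residue fields are never constructed; all statements are
  about subsets of \<open>B\<close> and multiplication by elements of \<open>C - p\<close>.\<close>

lemma left_ideal_add:
  assumes "left_ideal B I" "x \<in> I" "y \<in> I"
  shows "x + y \<in> I"
proof -
  have "0 - y \<in> I" using assms unfolding left_ideal_def by blast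
  then have "x - (0 - y) \<in> I" using assms unfolding left_ideal_def by blast
  then show ?thesis by simp
qed

lemma
  assumes "left_ideal B I"
  shows left_ideal_zero: "0 \<in> I"
    and left_ideal_diff: "x \<in> I \<Longrightarrow> y \<in> I \<Longrightarrow> x - y \<in> I"
    and left_ideal_mult: "b \<in> B \<Longrightarrow> x \<in> I \<Longrightarrow> b * x \<in> I"
    and left_ideal_subset: "I \<subseteq> B"
  using assms unfolding left_ideal_def by blast+

lemma left_ideal_minus:
  assumes "left_ideal B I" "x \<in> I"
  shows "- x \<in> I"
  using left_ideal_diff[OF assms(1) left_ideal_zero[OF assms(1)] assms(2)] by simp

lemma left_ideal_sum:
  assumes "left_ideal B I" "\<And>i. i \<in> A \<Longrightarrow> f i \<in> I"
  shows "sum f A \<in> I"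
  using assms(2)
  by (induction A rule: infinite_finite_induct)
     (auto simp: left_ideal_zero[OF assms(1)] intro!: left_ideal_add[OF assms(1)])

lemma left_ideal_cong:
  assumes "left_ideal B I" "x - y \<in> I"
  shows "x \<in> I \<longleftrightarrow> y \<in> I"
  using left_ideal_add[OF assms, of y] left_ideal_diff[OF assms(1) _ assms(2), of x] by auto

definition prime_in :: "'r::ring set \<Rightarrow> 'r \<Rightarrow> 'r set \<Rightarrow> bool" where
  "prime_in C u p \<longleftrightarrow> left_ideal C p \<and> u \<notin> p \<and> (\<forall>x\<in>C. \<forall>y\<in>C. x * y \<in> p \<longrightarrow> x \<in> p \<or> y \<in> p)"

text \<open>Jacobson property and Nullstellensatz in one statement. Asking for an inverse of
  \<open>z\<close> modulo a proper ideal, instead of a maximal ideal avoiding \<open>z\<close>, lets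
  an induction over the variables pass the condition on without choosing maximal ideals.\<close>

definition finitely_separated ::
    "('f::field \<Rightarrow> 'r::ring \<Rightarrow> 'r) \<Rightarrow> 'r set \<Rightarrow> 'r \<Rightarrow> bool" where
  "finitely_separated scale C u \<longleftrightarrow>
     (\<forall>p z. prime_in C u p \<longrightarrow> z \<in> C \<longrightarrow> z \<notin> p \<longrightarrow>
       (\<exists>m. left_ideal C m \<and> p \<subseteq> m \<and> u \<notin> m \<and> (\<exists>w\<in>C. w * z - u \<in> m) \<and>
            finite_codimension scale C m))"

text \<open>\<open>S\<close> may also be an ideal \<open>m\<close>: then \<open>polys_over m\<close>
  is the kernel of reducing coefficients modulo \<open>m\<close>, and congruence modulo it stands in
  for equality of polynomials over the quotient ring.\<close>

definition polys_over :: "'r::comm_ring_1 set \<Rightarrow> 'r poly set" where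
  "polys_over S = {f. \<forall>i. coeff f i \<in> S}"

section \<open>Polynomial arithmetic modulo an ideal of a subring\<close>

locale subring_of =
  fixes R :: "'r::comm_ring_1 set"
  assumes one_closed: "1 \<in> R"
    and diff_closed: "x \<in> R \<Longrightarrow> y \<in> R \<Longrightarrow> x - y \<in> R"
    and mult_closed: "x \<in> R \<Longrightarrow> y \<in> R \<Longrightarrow> x * y \<in> R"
begin

lemma ideal_self: "left_ideal R R"
  unfolding left_ideal_def using diff_closed[OF one_closed one_closed]
  by (auto intro: diff_closed mult_closed)

lemmas zero_closed = left_ideal_zero[OF ideal_self]
lemmas add_closed = left_ideal_add[OF ideal_self]
lemmas minus_closed = left_ideal_minus[OF ideal_self]

lemma power_closed: "x \<in> R \<Longrightarrow> x ^ n \<in> R"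
  by (induction n) (auto intro: one_closed mult_closed)

lemma ideal_mult_right: "left_ideal R m \<Longrightarrow> x \<in> m \<Longrightarrow> r \<in> R \<Longrightarrow> x * r \<in> m"
  using left_ideal_mult[of R m r x] by (simp add: mult.commute)

lemma polys_over_mono: "S \<subseteq> T \<Longrightarrow> polys_over S \<subseteq> polys_over T"
  unfolding polys_over_def by auto

lemma polys_over_zero: "left_ideal R m \<Longrightarrow> 0 \<in> polys_over m"
  unfolding polys_over_def by (simp add: left_ideal_zero)

lemma polys_over_add:
  "left_ideal R m \<Longrightarrow> f \<in> polys_over m \<Longrightarrow> g \<in> polys_over m \<Longrightarrow> f + g \<in> polys_over m"
  unfolding polys_over_def by (simp add: left_ideal_add)

lemma polys_over_diff:
  "left_ideal R m \<Longrightarrow> f \<in> polys_over m \<Longrightarrow> g \<in> polys_over m \<Longrightarrow> f - g \<in> polys_over m"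
  unfolding polys_over_def by (simp add: left_ideal_diff)

lemma polys_over_mult:
  "left_ideal R m \<Longrightarrow> f \<in> polys_over R \<Longrightarrow> g \<in> polys_over m \<Longrightarrow> f * g \<in> polys_over m"
  unfolding polys_over_def by (auto simp: coeff_mult intro!: left_ideal_sum left_ideal_mult)

lemma polys_over_smult:
  "left_ideal R m \<Longrightarrow> c \<in> R \<Longrightarrow> g \<in> polys_over m \<Longrightarrow> smult c g \<in> polys_over m"
  unfolding polys_over_def by (auto intro!: left_ideal_mult)

lemma polys_over_smult':
  "left_ideal R m \<Longrightarrow> c \<in> m \<Longrightarrow> g \<in> polys_over R \<Longrightarrow> smult c g \<in> polys_over m"
  unfolding polys_over_def by (auto intro!: ideal_mult_right)

lemma polys_over_pCons:
  "left_ideal R m \<Longrightarrow> c \<in> m \<Longrightarrow> g \<in> polys_over m \<Longrightarrow> pCons c g \<in> polys_over m"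
  unfolding polys_over_def by (auto simp: coeff_pCons split: nat.split)

lemma polys_over_monom:
  "left_ideal R m \<Longrightarrow> c \<in> m \<Longrightarrow> monom c k \<in> polys_over m"
  unfolding polys_over_def by (auto simp: left_ideal_zero)

lemma polys_over_one: "1 \<in> polys_over R"
  unfolding polys_over_def by (auto simp: coeff_1 one_closed zero_closed)

text \<open>The degree that matters is that of the reduction modulo \<open>m\<close>. Cutting off
  the coefficients above the last one outside \<open>m\<close> gives a representative whose actual
  degree equals it.\<close>

lemma polys_over_truncate:
  assumes m: "left_ideal R m" and f: "f \<in> polys_over R" "f \<notin> polys_over m"
  obtains g where "g \<in> polys_over R" "degree g \<le> degree f" "lead_coeff g \<notin> m" "f - g \<in> polys_over m"
proof -
  let ?A = "{i. coeff f i \<notin> m}"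
  have fin: "finite ?A"
    by (rule finite_subset[of _ "{..degree f}"])
       (auto simp: left_ideal_zero[OF m] intro: le_degree)
  have "?A \<noteq> {}" using f unfolding polys_over_def by auto
  define d where "d = Max ?A"
  have d: "coeff f d \<notin> m" using Max_in[OF fin \<open>?A \<noteq> {}\<close>] unfolding d_def by auto
  have le: "i \<le> d" if "coeff f i \<notin> m" for i using Max_ge[OF fin] that unfolding d_def by auto
  let ?g = "poly_cutoff (Suc d) f"
  have deg: "degree ?g = d"
  proof (rule antisym)
    show "degree ?g \<le> d" by (rule degree_le) (auto simp: coeff_poly_cutoff)
    show "d \<le> degree ?g" using d left_ideal_zero[OF m] by (intro le_degree) (auto simp: coeff_poly_cutoff)
  qed
  have ddeg: "d \<le> degree f" using d left_ideal_zero[OF m] by (intro le_degree) auto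
  show ?thesis
  proof (rule that)
    show "?g \<in> polys_over R" using f(1) unfolding polys_over_def
      by (auto simp: coeff_poly_cutoff zero_closed)
    show "lead_coeff ?g \<notin> m" using d by (simp add: deg coeff_poly_cutoff)
    show "degree ?g \<le> degree f" using ddeg deg by simp
    show "f - ?g \<in> polys_over m" using le left_ideal_zero[OF m] unfolding polys_over_def
      by (fastforce simp: coeff_poly_cutoff not_less_eq_eq Suc_le_eq)
  qed
qed

text \<open>The leading coefficient of \<open>h\<close> need not be invertible, so each elimination
  step multiplies by it once. Positive degree of \<open>h\<close> leaves room for a remainder of
  smaller degree.\<close>

lemma pseudo_division:
  assumes h: "h \<in> polys_over R" and f: "f \<in> polys_over R" and hpos: "degree h > 0"
  shows "\<exists>N q g. q \<in> polys_over R \<and> g \<in> polys_over R \<and> degree g < degree h \<and>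
           smult (lead_coeff h ^ N) f = q * h + g"
  using f
proof (induction "degree f" arbitrary: f rule: less_induct)
  case (less f)
  let ?c = "lead_coeff h"
  have c: "?c \<in> R" using h unfolding polys_over_def by auto
  show ?case
  proof (cases "degree f < degree h")
    case True
    have "smult (?c ^ 0) f = 0 * h + f" by simp
    then show ?thesis using True less.prems polys_over_zero[OF ideal_self] by blast
  next
    case False
    let ?k = "degree f - degree h"
    let ?t = "monom (lead_coeff f) ?k"
    let ?f' = "smult ?c f - ?t * h"
    have lf: "lead_coeff f \<in> R" using less.prems unfolding polys_over_def by auto
    have t: "?t \<in> polys_over R" using polys_over_monom[OF ideal_self lf] .
    have f': "?f' \<in> polys_over R"
      by (intro polys_over_diff[OF ideal_self] polys_over_smult[OF ideal_self] polys_over_mult[OF ideal_self] c t h less.prems)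
    have "degree ?f' < degree f"
    proof (rule degree_lessI)
      show "?f' \<noteq> 0 \<or> 0 < degree f" using False hpos by auto
      show "\<forall>k\<ge>degree f. coeff ?f' k = 0"
      proof (intro allI impI)
        fix k assume k: "degree f \<le> k"
        have "coeff (?t * h) k = lead_coeff f * coeff h (k - ?k)"
          using k by (simp add: coeff_monom_mult)
        moreover have "coeff h (k - ?k) = 0" if "k > degree f"
          using that False by (intro coeff_eq_0) auto
        moreover have "k - ?k = degree h" if "k = degree f" using that False by auto
        ultimately show "coeff ?f' k = 0" using k
          by (cases "k = degree f") (auto simp: coeff_eq_0 mult.commute)
      qed
    qed
    from less.hyps[OF this f'] obtain N q g where
      N: "q \<in> polys_over R" "g \<in> polys_over R" "degree g < degree h" "smult (?c ^ N) ?f' = q * h + g"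
      by blast
    have "smult (?c ^ Suc N) f = smult (?c ^ N) ?f' + smult (?c ^ N) ?t * h"
      by (simp add: smult_diff_right mult.commute)
    also have "\<dots> = (q + smult (?c ^ N) ?t) * h + g"
      unfolding N(4) by (simp add: distrib_right add.commute add.left_commute)
    finally have "smult (?c ^ Suc N) f = (q + smult (?c ^ N) ?t) * h + g" .
    moreover have "q + smult (?c ^ N) ?t \<in> polys_over R"
      by (intro polys_over_add[OF ideal_self] polys_over_smult[OF ideal_self] N t power_closed c)
    ultimately show ?thesis using N by blast
  qed
qed

text \<open>All terms of the convolution except one have a factor with index above \<open>d\<close>
  or above \<open>e\<close>, hence lie in \<open>m\<close>.\<close>

lemma coeff_mult_top_mod:
  assumes m: "left_ideal R m" and h: "h \<in> polys_over R" and q: "q \<in> polys_over R"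
    and hd: "\<And>i. i > d \<Longrightarrow> coeff h i \<in> m" and qe: "\<And>i. i > e \<Longrightarrow> coeff q i \<in> m"
  shows "coeff (h * q) (d + e) - coeff h d * coeff q e \<in> m"
proof -
  have "coeff (h * q) (d + e) = (\<Sum>i\<le>d + e. coeff h i * coeff q (d + e - i))"
    by (simp add: coeff_mult)
  also have "\<dots> = coeff h d * coeff q e + (\<Sum>i\<in>{..d + e} - {d}. coeff h i * coeff q (d + e - i))"
    by (subst sum.remove[of _ d]) auto
  finally have eq: "coeff (h * q) (d + e) - coeff h d * coeff q e =
      (\<Sum>i\<in>{..d + e} - {d}. coeff h i * coeff q (d + e - i))" by simp
  show ?thesis unfolding eq
  proof (rule left_ideal_sum[OF m])
    fix i assume i: "i \<in> {..d + e} - {d}"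
    have R: "coeff h i \<in> R" "coeff q (d + e - i) \<in> R" using h q unfolding polys_over_def by auto
    show "coeff h i * coeff q (d + e - i) \<in> m"
    proof (cases "i > d")
      case True
      then show ?thesis using ideal_mult_right[OF m hd R(2)] by simp
    next
      case False
      then have "d + e - i > e" using i by auto
      then show ?thesis using left_ideal_mult[OF m R(1) qe] by simp
    qed
  qed
qed

text \<open>Degrees add over the quotient by \<open>m\<close> when one leading coefficient is a
  unit, so a polynomial of positive degree can be invertible there only if the quotient is
  zero.\<close>

lemma not_unit_mod:
  assumes m: "left_ideal R m" and h: "h \<in> polys_over R" and q: "q \<in> polys_over R"
    and pos: "degree h > 0" and w: "w \<in> R" "w * lead_coeff h - 1 \<in> m"
    and eq: "1 - h * q \<in> polys_over m"
  shows "1 \<in> m"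
proof (rule ccontr)
  assume n1: "1 \<notin> m"
  have "q \<notin> polys_over m"
  proof
    assume "q \<in> polys_over m"
    then have "h * q \<in> polys_over m" by (rule polys_over_mult[OF m h])
    then have "1 \<in> polys_over m" using polys_over_add[OF m eq] by fastforce
    then have "coeff 1 0 \<in> m" unfolding polys_over_def by blast
    then show False using n1 by simp
  qed
  then obtain q' where q': "q' \<in> polys_over R" "lead_coeff q' \<notin> m" "q - q' \<in> polys_over m"
    using polys_over_truncate[OF m q] by metis
  have "h * (q - q') \<in> polys_over m" by (rule polys_over_mult[OF m h q'(3)])
  from polys_over_add[OF m eq this] have eq': "1 - h * q' \<in> polys_over m"
    by (simp add: algebra_simps)
  let ?k = "degree h + degree q'"
  have "coeff (1 - h * q') ?k \<in> m" using eq' unfolding polys_over_def by blast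
  then have "- coeff (h * q') ?k \<in> m" using pos by (simp add: coeff_1)
  then have A: "coeff (h * q') ?k \<in> m" using left_ideal_minus[OF m] by fastforce
  have "coeff (h * q') ?k - lead_coeff h * lead_coeff q' \<in> m"
    by (rule coeff_mult_top_mod[OF m h q'(1)]) (auto simp: coeff_eq_0 left_ideal_zero[OF m])
  then have "lead_coeff h * lead_coeff q' \<in> m" using A left_ideal_cong[OF m] by blast
  from left_ideal_mult[OF m w(1) this] have B: "w * lead_coeff h * lead_coeff q' \<in> m"
    by (simp add: mult.assoc)
  have "lead_coeff q' \<in> R" using q'(1) unfolding polys_over_def by blast
  from ideal_mult_right[OF m w(2) this]
  have "w * lead_coeff h * lead_coeff q' - lead_coeff q' \<in> m" by (simp add: algebra_simps)
  then show False using B q'(2) left_ideal_cong[OF m] by blast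
qed

end

section \<open>Extensions by one element: the transcendental and the algebraic case\<close>

locale simple_extension = subring_of R + base: subring_of R0 + vector_space scl
  for R R0 :: "'r::comm_ring_1 set" and scl :: "'f::field \<Rightarrow> 'r \<Rightarrow> 'r" +
  fixes y :: 'r
  assumes scl_mult: "scl c (a * b) = scl c a * b"
    and base_subset: "R0 \<subseteq> R"
    and y_closed: "y \<in> R"
    and generated: "x \<in> R \<Longrightarrow> \<exists>f\<in>polys_over R0. x = poly f y"
begin

lemma poly_in_ideal:
  assumes "left_ideal R m" "f \<in> polys_over m"
  shows "poly f y \<in> m"
  unfolding poly_altdef using assms(2) unfolding polys_over_def
  by (auto intro!: left_ideal_sum[OF assms(1)] ideal_mult_right[OF assms(1)] power_closed y_closed)

lemma poly_closed: "f \<in> polys_over R0 \<Longrightarrow> poly f y \<in> R"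
  using poly_in_ideal[OF ideal_self] base_subset unfolding polys_over_def by blast

text \<open>Modulo \<open>m\<close> the polynomial \<open>f\<close> becomes a monic relation for
  \<open>y\<close>. So powers of \<open>y\<close> below \<open>degree f\<close> span over
  \<open>R0\<close>, and their products with a spanning set of \<open>R0\<close> modulo
  \<open>m0\<close> span over the field.\<close>

lemma finite_codimension_extension:
  assumes m: "left_ideal R m" and m0: "left_ideal R0 m0" and sub: "m0 \<subseteq> m"
    and fin: "finite_codimension scl R0 m0"
    and f: "f \<in> polys_over R0" "poly f y \<in> m"
    and w: "w \<in> R0" "w * lead_coeff f - 1 \<in> m0"
  shows "finite_codimension scl R m"
proof -
  let ?D = "degree f"
  define V where "V = {x. \<exists>c. (\<forall>i. c i \<in> R0) \<and> x - (\<Sum>i<?D. c i * y ^ i) \<in> m}"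
  have V0: "x \<in> V" if "x \<in> m" for x
    unfolding V_def using that base.zero_closed by (auto intro!: exI[of _ "\<lambda>_. 0"])
  have Vadd: "x + x' \<in> V" if "x \<in> V" "x' \<in> V" for x x'
  proof -
    obtain c c' where c: "\<forall>i. c i \<in> R0" "x - (\<Sum>i<?D. c i * y ^ i) \<in> m"
      and c': "\<forall>i. c' i \<in> R0" "x' - (\<Sum>i<?D. c' i * y ^ i) \<in> m"
      using \<open>x \<in> V\<close> \<open>x' \<in> V\<close> unfolding V_def by blast
    have "x + x' - (\<Sum>i<?D. (c i + c' i) * y ^ i) =
        (x - (\<Sum>i<?D. c i * y ^ i)) + (x' - (\<Sum>i<?D. c' i * y ^ i))"
      by (simp add: distrib_right sum.distrib)
    then have "x + x' - (\<Sum>i<?D. (c i + c' i) * y ^ i) \<in> m"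
      using left_ideal_add[OF m c(2) c'(2)] by (simp only:)
    then show ?thesis unfolding V_def using c(1) c'(1) base.add_closed
      by (intro CollectI exI[of _ "\<lambda>i. c i + c' i"]) auto
  qed
  have Vmult: "r * x \<in> V" if r: "r \<in> R0" and "x \<in> V" for r x
  proof -
    obtain c where c: "\<forall>i. c i \<in> R0" "x - (\<Sum>i<?D. c i * y ^ i) \<in> m"
      using \<open>x \<in> V\<close> unfolding V_def by blast
    have "r * x - (\<Sum>i<?D. (r * c i) * y ^ i) = r * (x - (\<Sum>i<?D. c i * y ^ i))"
      by (simp add: right_diff_distrib sum_distrib_left mult.assoc)
    then have "r * x - (\<Sum>i<?D. (r * c i) * y ^ i) \<in> m"
      using left_ideal_mult[OF m _ c(2)] r base_subset by auto
    then show ?thesis unfolding V_def using c(1) r base.mult_closed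
      by (intro CollectI exI[of _ "\<lambda>i. r * c i"]) auto
  qed
  have Vsum: "sum g A \<in> V" if "\<And>i. i \<in> A \<Longrightarrow> g i \<in> V" for g and A :: "nat set"
    using that by (induction A rule: infinite_finite_induct)
      (auto intro!: Vadd V0[OF left_ideal_zero[OF m]])
  \<comment> \<open>The bound includes \<open>?D\<close>, because multiplication by \<open>y\<close>
    produces this power; it is the place where the relation \<open>poly f y \<in> m\<close> enters.
    The range also covers \<open>y ^ 0\<close> when the degree is zero.\<close>
  have pow: "y ^ k \<in> V" if "k \<le> ?D" for k
  proof (cases "k = ?D")
    case False
    have "(\<Sum>i<?D. (if i = k then 1 else 0) * y ^ i) = (\<Sum>i<?D. if i = k then y ^ i else 0)"
      by (rule sum.cong) auto
    also have "\<dots> = y ^ k" using False that by (subst sum.delta) auto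
    finally show ?thesis unfolding V_def
      using base.one_closed base.zero_closed left_ideal_zero[OF m]
      by (intro CollectI exI[of _ "\<lambda>i. if i = k then 1 else 0"]) auto
  next
    case True
    have wR: "w \<in> R" using w base_subset by blast
    have "w * poly f y \<in> m" by (rule left_ideal_mult[OF m wR f(2)])
    moreover have "(w * lead_coeff f - 1) * y ^ ?D \<in> m"
      using w sub by (intro ideal_mult_right[OF m] power_closed y_closed) auto
    ultimately have "w * poly f y - (w * lead_coeff f - 1) * y ^ ?D \<in> m"
      by (rule left_ideal_diff[OF m])
    also have "w * poly f y - (w * lead_coeff f - 1) * y ^ ?D =
        y ^ ?D - (\<Sum>i<?D. (- w * coeff f i) * y ^ i)"
      by (simp add: poly_altdef lessThan_Suc_atMost[symmetric] algebra_simps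
          sum_distrib_left sum_negf)
    finally show ?thesis unfolding V_def True using f(1) w(1) unfolding polys_over_def
      by (intro CollectI exI[of _ "\<lambda>i. - w * coeff f i"])
         (auto intro!: base.mult_closed base.minus_closed)
  qed
  have Vy: "y * x \<in> V" if "x \<in> V" for x
  proof -
    obtain c where c: "\<forall>i. c i \<in> R0" "x - (\<Sum>i<?D. c i * y ^ i) \<in> m"
      using \<open>x \<in> V\<close> unfolding V_def by blast
    have "(\<Sum>i<?D. c i * y ^ Suc i) \<in> V"
      using c(1) by (intro Vsum Vmult pow) auto
    moreover have "y * (x - (\<Sum>i<?D. c i * y ^ i)) \<in> V"
      by (intro V0 left_ideal_mult[OF m] y_closed c)
    ultimately have "(\<Sum>i<?D. c i * y ^ Suc i) + y * (x - (\<Sum>i<?D. c i * y ^ i)) \<in> V"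
      by (rule Vadd)
    then show ?thesis by (simp add: right_diff_distrib sum_distrib_left mult.left_commute)
  qed
  have Vpoly: "poly g y \<in> V" if "g \<in> polys_over R0" for g
    using that
  proof (induction g)
    case 0
    then show ?case using V0 left_ideal_zero[OF m] by simp
  next
    case (pCons a g)
    have "coeff (pCons a g) 0 \<in> R0" "\<And>i. coeff (pCons a g) (Suc i) \<in> R0"
      using pCons.prems unfolding polys_over_def by blast+
    then have a: "a \<in> R0" "g \<in> polys_over R0" unfolding polys_over_def by auto
    have "a * y ^ 0 + y * poly g y \<in> V" by (intro Vadd Vmult pow Vy a pCons.IH) simp
    then show ?case by simp
  qed
  obtain S where S: "finite S" "S \<subseteq> R0" "\<forall>v\<in>R0. \<exists>s\<in>span S. v - s \<in> m0"
    using fin unfolding finite_codimension_def by blast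
  let ?T = "(\<lambda>(s, i). s * y ^ i) ` (S \<times> {..<?D})"
  have span: "t * y ^ i \<in> span ?T" if "t \<in> span S" "i < ?D" for t i
    using that(1)
  proof (induction rule: span_induct_alt)
    case base
    then show ?case by (simp add: span_zero)
  next
    case (step c x z)
    have "x * y ^ i \<in> span ?T" using step(1) that(2) by (intro span_base) auto
    then have "scl c (x * y ^ i) + z * y ^ i \<in> span ?T" using step by (intro span_add span_scale)
    then show ?case by (simp add: distrib_right scl_mult)
  qed
  show ?thesis unfolding finite_codimension_def
  proof (intro exI[of _ ?T] conjI ballI)
    show "finite ?T" using S by blast
    show "?T \<subseteq> R" using S base_subset by (auto intro!: mult_closed power_closed y_closed)
    fix v assume "v \<in> R"
    then have "v \<in> V" using generated Vpoly by blast
    then obtain c where c: "\<forall>i. c i \<in> R0" "v - (\<Sum>i<?D. c i * y ^ i) \<in> m"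
      unfolding V_def by blast
    have "\<forall>i. \<exists>t\<in>span S. c i - t \<in> m0" using c S by blast
    then obtain t where t: "\<And>i. t i \<in> span S" "\<And>i. c i - t i \<in> m0" by metis
    have "(\<Sum>i<?D. (c i - t i) * y ^ i) \<in> m"
      using t(2) sub by (intro left_ideal_sum[OF m] ideal_mult_right[OF m] power_closed y_closed) blast
    from left_ideal_add[OF m c(2) this] have "v - (\<Sum>i<?D. t i * y ^ i) \<in> m"
      by (simp add: left_diff_distrib sum_subtractf)
    moreover have "(\<Sum>i<?D. t i * y ^ i) \<in> span ?T" using t(1) by (intro span_sum span) auto
    ultimately show "\<exists>s\<in>span ?T. v - s \<in> m" by blast
  qed
qed

text \<open>This is the ideal \<open>m0 R + J\<close>. Its elements are kept as values of
  polynomials over \<open>m0\<close>, so that a representation of \<open>1\<close> can be lifted to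
  an identity between polynomials.\<close>

lemma ideal_plus_extended:
  assumes J: "left_ideal R J" and m0: "left_ideal R0 m0"
  shows "left_ideal R {poly g y + x |g x. g \<in> polys_over m0 \<and> x \<in> J}" (is "left_ideal R ?m")
  unfolding left_ideal_def
proof (intro conjI ballI)
  have sub: "polys_over m0 \<subseteq> polys_over R0"
    using base.polys_over_mono left_ideal_subset[OF m0] .
  show "?m \<subseteq> R" using sub left_ideal_subset[OF J] by (auto intro!: add_closed poly_closed)
  have "0 = poly 0 y + 0" by simp
  then show "0 \<in> ?m" using left_ideal_zero[OF J] base.polys_over_zero[OF m0] by blast
next
  fix a b assume "a \<in> ?m" "b \<in> ?m"
  then obtain g x h z where *: "a = poly g y + x" "b = poly h y + z"
    "g \<in> polys_over m0" "h \<in> polys_over m0" "x \<in> J" "z \<in> J" by blast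
  then have "a - b = poly (g - h) y + (x - z)" by simp
  then show "a - b \<in> ?m"
    using * base.polys_over_diff[OF m0 *(3,4)] left_ideal_diff[OF J *(5,6)] by blast
next
  fix b a assume b: "b \<in> R" and "a \<in> ?m"
  then obtain g x where *: "a = poly g y + x" "g \<in> polys_over m0" "x \<in> J" by blast
  obtain f where f: "f \<in> polys_over R0" "b = poly f y" using generated b by blast
  have "b * a = poly (f * g) y + b * x" by (simp add: * f distrib_left)
  then show "b * a \<in> ?m"
    using base.polys_over_mult[OF m0 f(1) *(2)] left_ideal_mult[OF J b *(3)] by blast
qed

lemma extended_subset:
  assumes J: "left_ideal R J" and m0: "left_ideal R0 m0"
  shows "J \<subseteq> {poly g y + x |g x. g \<in> polys_over m0 \<and> x \<in> J}"
    and "m0 \<subseteq> {poly g y + x |g x. g \<in> polys_over m0 \<and> x \<in> J}"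
proof -
  have "x = poly 0 y + x" for x by simp
  then show "J \<subseteq> {poly g y + x |g x. g \<in> polys_over m0 \<and> x \<in> J}"
    using base.polys_over_zero[OF m0] by blast
  have "x = poly [:x:] y + 0" for x by simp
  moreover have "[:x:] \<in> polys_over m0" if "x \<in> m0" for x
    using that base.polys_over_pCons[OF m0 that base.polys_over_zero[OF m0]] by simp
  ultimately show "m0 \<subseteq> {poly g y + x |g x. g \<in> polys_over m0 \<and> x \<in> J}"
    using left_ideal_zero[OF J] by blast
qed

lemma ideal_plus_principal:
  assumes J: "left_ideal R J" and a: "a \<in> R"
  shows "left_ideal R {x + a * r |x r. x \<in> J \<and> r \<in> R}" (is "left_ideal R ?m")
  unfolding left_ideal_def
proof (intro conjI ballI)
  show "?m \<subseteq> R" using left_ideal_subset[OF J] a by (auto intro!: add_closed mult_closed)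
  have "0 = 0 + a * 0" by simp
  then show "0 \<in> ?m" using left_ideal_zero[OF J] zero_closed by blast
next
  fix b c assume "b \<in> ?m" "c \<in> ?m"
  then obtain x r x' r' where *: "b = x + a * r" "c = x' + a * r'" "x \<in> J" "x' \<in> J" "r \<in> R" "r' \<in> R"
    by blast
  then have "b - c = (x - x') + a * (r - r')" by (simp add: right_diff_distrib)
  then show "b - c \<in> ?m" using left_ideal_diff[OF J *(3,4)] diff_closed[OF *(5,6)] by blast
next
  fix b c assume b: "b \<in> R" and "c \<in> ?m"
  then obtain x r where *: "c = x + a * r" "x \<in> J" "r \<in> R" by blast
  then have "b * c = b * x + a * (b * r)" by (simp add: distrib_left mult.left_commute)
  then show "b * c \<in> ?m" using left_ideal_mult[OF J b *(2)] mult_closed[OF b *(3)] by blast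
qed

text \<open>Here \<open>R / p\<close> is a polynomial ring over \<open>R0 / (p \<inter> R0)\<close>.
  The induction hypothesis makes the leading coefficient of a polynomial \<open>g\<close>
  representing \<open>z\<close> a unit modulo \<open>m0\<close>; what remains is to divide out one
  polynomial with the same leading coefficient.\<close>

lemma finite_codimension_point_transcendental:
  assumes p: "left_ideal R p" and z: "z \<in> R" "z \<notin> p"
    and transc: "\<And>f. f \<in> polys_over R0 \<Longrightarrow> poly f y \<in> p \<Longrightarrow> f \<in> polys_over p"
    and IH: "\<And>c. c \<in> R0 \<Longrightarrow> c \<notin> p \<Longrightarrow> \<exists>m. left_ideal R0 m \<and> p \<inter> R0 \<subseteq> m \<and> 1 \<notin> m \<and>
      (\<exists>w\<in>R0. w * c - 1 \<in> m) \<and> finite_codimension scl R0 m"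
  shows "\<exists>m. left_ideal R m \<and> p \<subseteq> m \<and> 1 \<notin> m \<and> (\<exists>w\<in>R. w * z - 1 \<in> m) \<and> finite_codimension scl R m"
proof -
  have p0: "left_ideal R0 (p \<inter> R0)"
    using p base_subset base.ideal_self unfolding left_ideal_def by blast
  obtain g' where g': "g' \<in> polys_over R0" "z = poly g' y" using generated z by blast
  have "g' \<notin> polys_over (p \<inter> R0)"
  proof
    assume "g' \<in> polys_over (p \<inter> R0)"
    then have "g' \<in> polys_over p" unfolding polys_over_def by auto
    then show False using poly_in_ideal[OF p] z(2) g'(2) by blast
  qed
  then obtain g where g: "g \<in> polys_over R0" "lead_coeff g \<notin> p \<inter> R0" "g' - g \<in> polys_over (p \<inter> R0)"
    using base.polys_over_truncate[OF p0 g'(1)] by metis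
  have lg: "lead_coeff g \<in> R0" using g unfolding polys_over_def by blast
  have g0: "g \<noteq> 0" using g(2) left_ideal_zero[OF p0] by auto
  from IH[OF lg] g(2) lg obtain m0 w where m0: "left_ideal R0 m0" "p \<inter> R0 \<subseteq> m0" "1 \<notin> m0"
      "w \<in> R0" "w * lead_coeff g - 1 \<in> m0" "finite_codimension scl R0 m0" by blast
  \<comment> \<open>The relation \<open>1 + y * z = 0\<close> turns \<open>- y\<close> into an
    inverse of \<open>z\<close>. The shift gives positive degree even for constant \<open>g\<close>
    and preserves the leading coefficient, as \<open>not_unit_mod\<close> requires.\<close>
  let ?h = "1 + pCons 0 g"
  have dh: "degree ?h = Suc (degree g)"
    using g0 by (subst degree_add_eq_right) auto
  have lh: "lead_coeff ?h = lead_coeff g" unfolding dh by simp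
  have h: "?h \<in> polys_over R0"
    by (intro base.polys_over_add[OF base.ideal_self] base.polys_over_one
        base.polys_over_pCons[OF base.ideal_self] base.zero_closed g)
  have hR: "poly ?h y \<in> R" by (rule poly_closed[OF h])
  define J where "J = {x + poly ?h y * r |x r. x \<in> p \<and> r \<in> R}"
  have J: "left_ideal R J" unfolding J_def by (rule ideal_plus_principal[OF p hR])
  have pJ: "p \<subseteq> J"
  proof
    fix x assume "x \<in> p"
    moreover have "x = x + poly ?h y * 0" by simp
    ultimately show "x \<in> J" unfolding J_def using zero_closed by blast
  qed
  have hJ: "poly ?h y \<in> J"
  proof -
    have "poly ?h y = 0 + poly ?h y * 1" by simp
    then show ?thesis unfolding J_def using left_ideal_zero[OF p] one_closed by blast
  qed
  define m where "m = {poly g y + x |g x. g \<in> polys_over m0 \<and> x \<in> J}"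
  have m: "left_ideal R m" unfolding m_def by (rule ideal_plus_extended[OF J m0(1)])
  have Jm: "J \<subseteq> m" and m0m: "m0 \<subseteq> m" unfolding m_def by (rule extended_subset[OF J m0(1)])+
  \<comment> \<open>As \<open>y\<close> is transcendental modulo \<open>p\<close>, a representation
    of \<open>1\<close> lifts to polynomials and would make \<open>?h\<close> invertible modulo
    \<open>m0\<close>.\<close>
  have "1 \<notin> m"
  proof
    assume "1 \<in> m"
    then obtain k x r where k: "1 = poly k y + (x + poly ?h y * r)" "k \<in> polys_over m0" "x \<in> p" "r \<in> R"
      unfolding m_def J_def by blast
    obtain q where q: "q \<in> polys_over R0" "r = poly q y" using generated k(4) by blast
    let ?f = "1 - ?h * q - k"
    have kR: "k \<in> polys_over R0" using k(2) base.polys_over_mono[OF left_ideal_subset[OF m0(1)]] by blast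
    have "poly ?f y = x" using k(1) unfolding q(2) by (simp add: algebra_simps)
    moreover have f: "?f \<in> polys_over R0"
      by (intro base.polys_over_diff[OF base.ideal_self] base.polys_over_mult[OF base.ideal_self]
          base.polys_over_one h q kR)
    ultimately have "?f \<in> polys_over p" using transc k(3) by metis
    then have "?f \<in> polys_over m0" using m0(2) f unfolding polys_over_def by blast
    from base.polys_over_add[OF m0(1) this k(2)] have "1 - ?h * q \<in> polys_over m0"
      by simp
    from base.not_unit_mod[OF m0(1) h q(1) _ m0(4) _ this] m0(3,5) show False
      unfolding lh dh by simp
  qed
  moreover have "- y * z - 1 \<in> m"
  proof -
    have "poly (g' - g) y \<in> p"
      using poly_in_ideal[OF p, of "g' - g"] g(3) unfolding polys_over_def by auto
    then have "y * poly (g' - g) y \<in> m" using left_ideal_mult[OF p y_closed] pJ Jm by blast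
    moreover have "poly ?h y \<in> m" using hJ Jm by blast
    ultimately have "- (y * poly (g' - g) y + poly ?h y) \<in> m"
      using left_ideal_add[OF m] left_ideal_minus[OF m] by blast
    moreover have "- (y * poly (g' - g) y + poly ?h y) = - y * z - 1"
      unfolding g'(2) by (simp add: algebra_simps)
    ultimately show ?thesis by (simp only:)
  qed
  moreover have "finite_codimension scl R m"
    by (rule finite_codimension_extension[OF m m0(1) m0m m0(6) h _ m0(4)]) (use hJ Jm m0(5) lh in auto)
  ultimately show ?thesis using m pJ Jm minus_closed[OF y_closed] by blast
qed

text \<open>The minimal degree of a nonzero multiple of \<open>z\<close> modulo \<open>p\<close> is zero, by Euclidean division
  of a minimal relation of \<open>y\<close> over \<open>p \<inter> R0\<close> by such a multiple.\<close>

lemma multiple_in_base: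
  assumes p: "prime_in R 1 p" and z: "z \<in> R" "z \<notin> p"
    and f: "f \<in> polys_over R0" "lead_coeff f \<notin> p" "poly f y \<in> p"
    and min: "\<And>g. g \<in> polys_over R0 \<Longrightarrow> degree g < degree f \<Longrightarrow> poly g y \<in> p \<Longrightarrow> g \<in> polys_over p"
  obtains v x where "v \<in> R" "x \<in> p" "v * z + x \<in> R0" "v * z + x \<notin> p"
proof -
  have pid: "left_ideal R p" and n1: "1 \<notin> p"
    and prime: "\<And>a b. a \<in> R \<Longrightarrow> b \<in> R \<Longrightarrow> a * b \<in> p \<Longrightarrow> a \<in> p \<or> b \<in> p"
    using p unfolding prime_in_def by auto
  have p0: "left_ideal R0 (p \<inter> R0)"
    using pid base_subset base.ideal_self unfolding left_ideal_def by blast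
  have primepow: "a ^ N \<notin> p" if "a \<in> R" "a \<notin> p" for a N
    using that by (induction N) (use n1 prime power_closed in auto)
  define W where "W = {x + z * r |x r. x \<in> p \<and> r \<in> R}"
  have W: "left_ideal R W" unfolding W_def by (rule ideal_plus_principal[OF pid z(1)])
  have pW: "p \<subseteq> W"
  proof
    fix x assume "x \<in> p"
    moreover have "x = x + z * 0" by simp
    ultimately show "x \<in> W" unfolding W_def using zero_closed by blast
  qed
  \<comment> \<open>The values are multiples of \<open>z\<close> modulo \<open>p\<close> and nonzero
    there; the condition on the leading coefficient makes \<open>degree\<close> the degree of the
    reduction modulo \<open>p\<close>.\<close>
  define P where "P = (\<lambda>h. h \<in> polys_over R0 \<and> lead_coeff h \<notin> p \<and> poly h y \<in> W \<and> poly h y \<notin> p)"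
  have lowP: "\<exists>h'. P h' \<and> degree h' \<le> degree h"
    if h: "h \<in> polys_over R0" "poly h y \<in> W" "poly h y \<notin> p" for h
  proof -
    have "h \<notin> polys_over (p \<inter> R0)"
    proof
      assume "h \<in> polys_over (p \<inter> R0)"
      then have "h \<in> polys_over p" unfolding polys_over_def by auto
      then show False using poly_in_ideal[OF pid] h(3) by blast
    qed
    then obtain k where k: "k \<in> polys_over R0" "degree k \<le> degree h" "lead_coeff k \<notin> p \<inter> R0"
        "h - k \<in> polys_over (p \<inter> R0)"
      using base.polys_over_truncate[OF p0 h(1)] by metis
    have "poly (h - k) y \<in> p"
      using poly_in_ideal[OF pid, of "h - k"] k(4) unfolding polys_over_def by auto
    then have d: "poly h y - poly k y \<in> p" by simp
    then have "poly k y \<in> W" "poly k y \<notin> p"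
      using left_ideal_cong[OF pid d] left_ideal_cong[OF W, of "poly h y" "poly k y"] pW h by auto
    moreover have "lead_coeff k \<notin> p" using k(1,3) unfolding polys_over_def by auto
    ultimately show ?thesis using k unfolding P_def by blast
  qed
  have "\<exists>h. P h"
  proof -
    obtain h where h: "h \<in> polys_over R0" "z = poly h y" using generated z(1) by blast
    have "z = 0 + z * 1" by simp
    then have "z \<in> W" unfolding W_def using left_ideal_zero[OF pid] one_closed by blast
    then show ?thesis using lowP[OF h(1)] h(2) z(2) by metis
  qed
  then obtain h where h: "P h" and hmin: "\<And>k. P k \<Longrightarrow> degree h \<le> degree k"
    using ex_has_least_nat[of P _ degree] by blast
  note hP = h[unfolded P_def]
  have hR: "poly h y \<in> R" using hP poly_closed by blast
  have lhR: "lead_coeff h \<in> R0" "lead_coeff f \<in> R0" using hP f unfolding polys_over_def by auto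
  have "degree h = 0"
  proof (rule ccontr)
    assume "degree h \<noteq> 0"
    then have hpos: "degree h > 0" by simp
    \<comment> \<open>Otherwise dividing \<open>h\<close> by \<open>f\<close> leaves a remainder of
      smaller degree with the same value modulo \<open>p\<close>, up to a factor outside
      \<open>p\<close>.\<close>
    have lt: "degree h < degree f"
    proof (rule ccontr)
      assume "\<not> degree h < degree f"
      then have le: "degree f \<le> degree h" by simp
      show False
      proof (cases "degree f = 0")
        case True
        then obtain c where "f = [:c:]" using degree_eq_zeroE by blast
        then show False using f by simp
      next
        case False
        then obtain N q g where N: "q \<in> polys_over R0" "g \<in> polys_over R0" "degree g < degree f"
            "smult (lead_coeff f ^ N) h = q * f + g"
          using base.pseudo_division[OF f(1), of h] hP by blast
        have eq: "lead_coeff f ^ N * poly h y = poly q y * poly f y + poly g y"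
          using arg_cong[OF N(4), of "\<lambda>f. poly f y"] by simp
        have fN: "lead_coeff f ^ N \<in> R" using lhR base_subset power_closed by blast
        have "lead_coeff f ^ N * poly h y \<notin> p"
          using prime[OF fN hR] primepow[OF subsetD[OF base_subset lhR(2)] f(2), of N] hP by blast
        moreover have "lead_coeff f ^ N * poly h y \<in> W" using left_ideal_mult[OF W fN] hP by blast
        moreover have d: "lead_coeff f ^ N * poly h y - poly g y \<in> p"
          unfolding eq using left_ideal_mult[OF pid poly_closed[OF N(1)] f(3)] by simp
        ultimately have "poly g y \<in> W" "poly g y \<notin> p"
          using left_ideal_cong[OF pid d] left_ideal_cong[OF W subsetD[OF pW d]] by auto
        then show False using lowP[OF N(2)] hmin N(3) le by fastforce
      qed
    qed
    \<comment> \<open>Now \<open>f\<close> is divided by \<open>h\<close>. The value of the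
      remainder lies in \<open>W\<close>, hence in \<open>p\<close> by minimality of
      \<open>h\<close>, and then its coefficients lie in \<open>p\<close> by minimality of
      \<open>f\<close>. Since \<open>h\<close> has a value outside \<open>p\<close>, the value of
      the quotient \<open>q\<close> lies in \<open>p\<close>.\<close>
    obtain N q g where N: "q \<in> polys_over R0" "g \<in> polys_over R0" "degree g < degree h"
        "smult (lead_coeff h ^ N) f = q * h + g"
      using base.pseudo_division[of h f] hP f hpos by blast
    have hN: "lead_coeff h ^ N \<in> R0" using lhR base.power_closed by blast
    have eq: "lead_coeff h ^ N * poly f y = poly q y * poly h y + poly g y"
      using arg_cong[OF N(4), of "\<lambda>f. poly f y"] by simp
    have fin: "lead_coeff h ^ N * poly f y \<in> p"
      using left_ideal_mult[OF pid _ f(3)] hN base_subset by blast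
    have qh: "poly q y * poly h y \<in> W" using left_ideal_mult[OF W] poly_closed[OF N(1)] hP by blast
    have "poly g y = lead_coeff h ^ N * poly f y - poly q y * poly h y" using eq by simp
    then have "poly g y \<in> W" using left_ideal_diff[OF W _ qh] fin pW by auto
    then have gp: "poly g y \<in> p" using lowP[OF N(2)] hmin N(3) by fastforce
    then have g: "g \<in> polys_over p" using min N(2,3) lt by simp
    have "poly q y * poly h y = lead_coeff h ^ N * poly f y - poly g y" using eq by simp
    then have "poly q y * poly h y \<in> p" using left_ideal_diff[OF pid fin gp] by simp
    then have qp: "poly q y \<in> p" using prime[OF poly_closed[OF N(1)] hR] hP by blast
    \<comment> \<open>The top coefficient of \<open>h * q\<close> modulo \<open>p\<close> shows that
      the reduction of \<open>q\<close> has degree at most \<open>degree f - degree h\<close>. So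
      \<open>q\<close> is a relation shorter than \<open>f\<close> and must be trivial. A multiple
      of \<open>f\<close> by a factor outside \<open>p\<close> then has all its coefficients in
      \<open>p\<close>, which is absurd.\<close>
    have "q \<in> polys_over (p \<inter> R0)"
    proof (rule ccontr)
      assume "q \<notin> polys_over (p \<inter> R0)"
      then obtain k where k: "k \<in> polys_over R0" "lead_coeff k \<notin> p \<inter> R0" "q - k \<in> polys_over (p \<inter> R0)"
        using base.polys_over_truncate[OF p0 N(1)] by metis
      have lk: "lead_coeff k \<notin> p" using k unfolding polys_over_def by auto
      have above: "coeff q i \<in> p \<longleftrightarrow> coeff k i \<in> p" for i
        using k(3) left_ideal_cong[OF pid, of "coeff q i" "coeff k i"] unfolding polys_over_def by auto
      have R0R: "polys_over R0 \<subseteq> polys_over R" by (rule polys_over_mono[OF base_subset])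
      let ?e = "degree k"
      have "coeff (h * q) (degree h + ?e) - coeff h (degree h) * coeff q ?e \<in> p"
        by (rule coeff_mult_top_mod[OF pid])
           (use hP N R0R left_ideal_zero[OF pid] above in \<open>auto simp: coeff_eq_0\<close>)
      moreover have "coeff h (degree h) * coeff q ?e \<notin> p"
      proof -
        have "coeff q ?e \<in> R" using N(1) base_subset unfolding polys_over_def by blast
        then show ?thesis
          using prime[OF subsetD[OF base_subset lhR(1)]] above[of ?e] lk hP by blast
      qed
      ultimately have "coeff (h * q) (degree h + ?e) \<notin> p" using left_ideal_cong[OF pid] by blast
      moreover have "h * q = smult (lead_coeff h ^ N) f - g"
        unfolding N(4) mult.commute[of h q] by (rule add_diff_cancel_right'[symmetric])
      ultimately have "lead_coeff h ^ N * coeff f (degree h + ?e) - coeff g (degree h + ?e) \<notin> p"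
        by (simp only: coeff_diff coeff_smult not_False_eq_True)
      moreover have "coeff g (degree h + ?e) \<in> p" using g unfolding polys_over_def by blast
      ultimately have "lead_coeff h ^ N * coeff f (degree h + ?e) \<notin> p"
        using left_ideal_diff[OF pid] by blast
      then have "coeff f (degree h + ?e) \<noteq> 0" using left_ideal_zero[OF pid] by auto
      then have "degree h + ?e \<le> degree f" by (rule le_degree)
      then have "?e < degree f" using hpos by simp
      moreover have "poly k y \<in> p"
      proof -
        have "poly (q - k) y \<in> p"
          using poly_in_ideal[OF pid, of "q - k"] k(3) unfolding polys_over_def by auto
        then show ?thesis using left_ideal_cong[OF pid, of "poly q y" "poly k y"] qp by simp
      qed
      ultimately have "k \<in> polys_over p" using min[OF k(1)] by blast
      then show False using lk unfolding polys_over_def by blast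
    qed
    then have "q \<in> polys_over p" unfolding polys_over_def by auto
    moreover have "h \<in> polys_over R" using hP polys_over_mono[OF base_subset] by blast
    ultimately have "h * q \<in> polys_over p" using polys_over_mult[OF pid] by blast
    then have "smult (lead_coeff h ^ N) f \<in> polys_over p"
      unfolding N(4) using polys_over_add[OF pid _ g] by (simp add: mult.commute)
    then have "coeff (smult (lead_coeff h ^ N) f) (degree f) \<in> p" unfolding polys_over_def by blast
    then have "lead_coeff h ^ N * lead_coeff f \<in> p" by simp
    moreover have "lead_coeff h ^ N \<notin> p" using primepow lhR base_subset hP by blast
    ultimately show False
      using prime[of "lead_coeff h ^ N" "lead_coeff f"] hN lhR base_subset f(2) by blast
  qed
  then obtain c where c: "h = [:c:]" using degree_eq_zeroE by blast
  then have "c \<in> R0" "c \<in> W" "c \<notin> p" using hP lhR by auto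
  then obtain x r where "c = x + z * r" "x \<in> p" "r \<in> R" unfolding W_def by blast
  then show ?thesis using that[of r x] \<open>c \<in> R0\<close> \<open>c \<notin> p\<close> by (simp add: algebra_simps)
qed

text \<open>Once the leading coefficient of the minimal relation \<open>f\<close> is a unit modulo
  \<open>m0\<close>, division by \<open>f\<close> shows that \<open>p + m0 R\<close> is still
  proper. For \<open>z\<close> to become a unit it suffices that some multiple of it that lies in
  \<open>R0\<close> modulo \<open>p\<close> does.\<close>

lemma finite_codimension_point_algebraic:
  assumes p: "prime_in R 1 p" and z: "z \<in> R" "z \<notin> p"
    and f: "f \<in> polys_over R0" "lead_coeff f \<notin> p" "poly f y \<in> p"
    and min: "\<And>g. g \<in> polys_over R0 \<Longrightarrow> degree g < degree f \<Longrightarrow> poly g y \<in> p \<Longrightarrow> g \<in> polys_over p"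
    and IH: "\<And>c. c \<in> R0 \<Longrightarrow> c \<notin> p \<Longrightarrow> \<exists>m. left_ideal R0 m \<and> p \<inter> R0 \<subseteq> m \<and> 1 \<notin> m \<and>
      (\<exists>w\<in>R0. w * c - 1 \<in> m) \<and> finite_codimension scl R0 m"
  shows "\<exists>m. left_ideal R m \<and> p \<subseteq> m \<and> 1 \<notin> m \<and> (\<exists>w\<in>R. w * z - 1 \<in> m) \<and> finite_codimension scl R m"
proof -
  have pid: "left_ideal R p" and n1: "1 \<notin> p"
    and prime: "\<And>a b. a \<in> R \<Longrightarrow> b \<in> R \<Longrightarrow> a * b \<in> p \<Longrightarrow> a \<in> p \<or> b \<in> p"
    using p unfolding prime_in_def by auto
  have p0: "left_ideal R0 (p \<inter> R0)"
    using pid base_subset base.ideal_self unfolding left_ideal_def by blast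
  obtain v x where v: "v \<in> R" "x \<in> p" "v * z + x \<in> R0" "v * z + x \<notin> p"
    using multiple_in_base[OF p z f min] .
  let ?l = "lead_coeff f"
  have lR: "?l \<in> R0" using f unfolding polys_over_def by blast
  \<comment> \<open>Applying the induction hypothesis to the product makes both factors units modulo
    \<open>m0\<close>: the leading coefficient and the multiple of \<open>z\<close>.\<close>
  have cR: "?l * (v * z + x) \<in> R0" using base.mult_closed[OF lR v(3)] .
  have "?l * (v * z + x) \<notin> p" using prime lR v base_subset f by blast
  from IH[OF cR this] obtain m0 w where m0: "left_ideal R0 m0" "p \<inter> R0 \<subseteq> m0" "1 \<notin> m0"
      "w \<in> R0" "w * (?l * (v * z + x)) - 1 \<in> m0" "finite_codimension scl R0 m0" by blast
  have w': "w * (v * z + x) \<in> R0" by (rule base.mult_closed[OF m0(4) v(3)])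
  have w'1: "w * (v * z + x) * ?l - 1 \<in> m0" using m0(5) by (simp add: mult_ac)
  have fpos: "degree f > 0"
  proof (rule ccontr)
    assume "\<not> degree f > 0"
    then have "degree f = 0" by simp
    then obtain c where "f = [:c:]" using degree_eq_zeroE by blast
    then show False using f by simp
  qed
  define m where "m = {poly g y + x |g x. g \<in> polys_over m0 \<and> x \<in> p}"
  have m: "left_ideal R m" unfolding m_def by (rule ideal_plus_extended[OF pid m0(1)])
  have pm: "p \<subseteq> m" and m0m: "m0 \<subseteq> m" unfolding m_def by (rule extended_subset[OF pid m0(1)])+
  have "1 \<notin> m"
  proof
    assume "1 \<in> m"
    then obtain g x where g: "1 = poly g y + x" "g \<in> polys_over m0" "x \<in> p" unfolding m_def by blast
    have gR: "g \<in> polys_over R0" using g(2) base.polys_over_mono[OF left_ideal_subset[OF m0(1)]] by blast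
    let ?k = "1 - g"
    have k: "?k \<in> polys_over R0" by (intro base.polys_over_diff[OF base.ideal_self] base.polys_over_one gR)
    have "poly ?k y = x" using g(1) by (simp add: algebra_simps)
    then have kp: "poly ?k y \<in> p" using g(3) by (simp only:)
    \<comment> \<open>The value of \<open>1 - g\<close> lies in \<open>p\<close>, so the remainder
      \<open>h\<close> is trivial by minimality of \<open>f\<close>. As \<open>g\<close> vanishes
      modulo \<open>m0\<close>, this says that \<open>f\<close> divides the unit
      \<open>?l ^ N\<close> there, against \<open>not_unit_mod\<close>.\<close>
    obtain N q h where N: "q \<in> polys_over R0" "h \<in> polys_over R0" "degree h < degree f"
        "smult (?l ^ N) ?k = q * f + h"
      using base.pseudo_division[OF f(1) k fpos] by blast
    have lN: "?l ^ N \<in> R" using lR base_subset power_closed by blast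
    have "poly h y = ?l ^ N * poly ?k y - poly q y * poly f y"
      using arg_cong[OF N(4), of "\<lambda>f. poly f y"] by simp
    then have "poly h y \<in> p"
      using left_ideal_diff[OF pid left_ideal_mult[OF pid lN kp]
        left_ideal_mult[OF pid poly_closed[OF N(1)] f(3)]] by simp
    then have "h \<in> polys_over p" using min N by blast
    then have hm0: "h \<in> polys_over m0" using N(2) m0(2) unfolding polys_over_def by blast
    obtain w' where w': "w' \<in> R0" "w' * ?l - 1 \<in> m0"
      using base.mult_closed[OF m0(4) v(3)] w'1 by blast
    have w'N: "w' ^ N \<in> R0" using w' base.power_closed by blast
    have unit: "w' ^ N * ?l ^ N - 1 \<in> m0"
    proof (induction N)
      case (Suc N)
      have "(w' * ?l) * (w' ^ N * ?l ^ N - 1) + (w' * ?l - 1) \<in> m0"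
        by (intro left_ideal_add[OF m0(1)] left_ideal_mult[OF m0(1)] base.mult_closed w' lR Suc)
      then show ?case by (simp add: algebra_simps)
    qed (simp add: left_ideal_zero[OF m0(1)])
    have "smult (w' ^ N) (smult (?l ^ N) ?k) = smult (w' ^ N) (q * f + h)" using N(4) by simp
    then have eq: "smult (w' ^ N * ?l ^ N) ?k = f * smult (w' ^ N) q + smult (w' ^ N) h"
      by (simp add: smult_add_right mult.commute)
    have "1 - f * smult (w' ^ N) q = smult (w' ^ N) h - smult (w' ^ N * ?l ^ N - 1) ?k + g"
      using eq by (simp add: smult_diff_left algebra_simps)
    also have "\<dots> \<in> polys_over m0"
      by (intro base.polys_over_add[OF m0(1)] base.polys_over_diff[OF m0(1)]
          base.polys_over_smult[OF m0(1)] base.polys_over_smult'[OF m0(1)] hm0 w'N unit k g)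
    finally have "1 - f * smult (w' ^ N) q \<in> polys_over m0" .
    from base.not_unit_mod[OF m0(1) f(1) base.polys_over_smult[OF base.ideal_self w'N N(1)] fpos w' this]
    show False using m0(3) by blast
  qed
  moreover have "w * ?l * v * z - 1 \<in> m"
  proof -
    have wl: "w * ?l \<in> R" using m0(4) lR base_subset mult_closed by blast
    have "w * (?l * (v * z + x)) - 1 - w * ?l * x \<in> m"
      using left_ideal_diff[OF m] m0(5) m0m left_ideal_mult[OF pid wl v(2)] pm by blast
    then show ?thesis by (simp add: algebra_simps)
  qed
  moreover have "w * ?l * v \<in> R" using m0(4) lR v(1) base_subset mult_closed by blast
  moreover have "finite_codimension scl R m"
    by (rule finite_codimension_extension[OF m m0(1) m0m m0(6) f(1) _ w' w'1]) (use f pm in auto)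
  ultimately show ?thesis using m pm by blast
qed

text \<open>The contraction of \<open>p\<close> to \<open>R0\<close> is prime. A nontrivial relation
  of \<open>y\<close> modulo \<open>p\<close> can be truncated to one with leading coefficient
  outside \<open>p\<close>, and whether one exists decides between the two cases.\<close>

lemma finitely_separated_extension:
  assumes "finitely_separated scl R0 1"
  shows "finitely_separated scl R 1"
  unfolding finitely_separated_def
proof (intro allI impI)
  fix p z assume p: "prime_in R 1 p" and z: "z \<in> R" "z \<notin> p"
  have pid: "left_ideal R p" and n1: "1 \<notin> p"
    and prime: "\<And>a b. a \<in> R \<Longrightarrow> b \<in> R \<Longrightarrow> a * b \<in> p \<Longrightarrow> a \<in> p \<or> b \<in> p"
    using p unfolding prime_in_def by auto
  have p0: "left_ideal R0 (p \<inter> R0)"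
    using pid base_subset base.ideal_self unfolding left_ideal_def by blast
  have "prime_in R0 1 (p \<inter> R0)"
    unfolding prime_in_def using p0 n1 prime base_subset by blast
  then have IH: "\<exists>m. left_ideal R0 m \<and> p \<inter> R0 \<subseteq> m \<and> 1 \<notin> m \<and>
      (\<exists>w\<in>R0. w * c - 1 \<in> m) \<and> finite_codimension scl R0 m" if "c \<in> R0" "c \<notin> p" for c
    using assms that unfolding finitely_separated_def by blast
  define P where "P = (\<lambda>f. f \<in> polys_over R0 \<and> lead_coeff f \<notin> p \<and> poly f y \<in> p)"
  have low: "\<exists>g. P g \<and> degree g \<le> degree f"
    if f: "f \<in> polys_over R0" "poly f y \<in> p" "f \<notin> polys_over p" for f
  proof -
    have "f \<notin> polys_over (p \<inter> R0)" using f(3) unfolding polys_over_def by blast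
    then obtain k where k: "k \<in> polys_over R0" "degree k \<le> degree f" "lead_coeff k \<notin> p \<inter> R0"
        "f - k \<in> polys_over (p \<inter> R0)"
      using base.polys_over_truncate[OF p0 f(1)] by metis
    have "poly (f - k) y \<in> p"
      using poly_in_ideal[OF pid, of "f - k"] k(4) unfolding polys_over_def by auto
    then have "poly k y \<in> p" using left_ideal_cong[OF pid, of "poly f y" "poly k y"] f by simp
    moreover have "lead_coeff k \<notin> p" using k(1,3) unfolding polys_over_def by auto
    ultimately show ?thesis using k unfolding P_def by blast
  qed
  show "\<exists>m. left_ideal R m \<and> p \<subseteq> m \<and> 1 \<notin> m \<and> (\<exists>w\<in>R. w * z - 1 \<in> m) \<and> finite_codimension scl R m"
  proof (cases "\<exists>f. P f")
    case False
    then have transc: "f \<in> polys_over p" if "f \<in> polys_over R0" "poly f y \<in> p" for f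
      using low that by blast
    show ?thesis by (rule finite_codimension_point_transcendental[OF pid z transc IH])
  next
    case True
    then obtain f where f: "P f" and fmin: "\<And>k. P k \<Longrightarrow> degree f \<le> degree k"
      using ex_has_least_nat[of P _ degree] by blast
    have min: "g \<in> polys_over p" if "g \<in> polys_over R0" "degree g < degree f" "poly g y \<in> p" for g
      using low that fmin by fastforce
    show ?thesis
      by (rule finite_codimension_point_algebraic[OF p z _ _ _ min IH]) (use f in \<open>auto simp: P_def\<close>)
  qed
qed

end

section \<open>Rings that are finite over a central subring\<close>

lemma left_ideal_Union_chain:
  assumes "\<C> \<noteq> {}" "subset.chain A \<C>" "\<And>X. X \<in> \<C> \<Longrightarrow> left_ideal B X"
  shows "left_ideal B (\<Union>\<C>)"
  unfolding left_ideal_def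
proof (intro conjI ballI)
  show "\<Union>\<C> \<subseteq> B" "0 \<in> \<Union>\<C>" using assms left_ideal_subset left_ideal_zero by blast+
next
  fix x y assume "x \<in> \<Union>\<C>" "y \<in> \<Union>\<C>"
  then obtain X Y where XY: "X \<in> \<C>" "Y \<in> \<C>" "x \<in> X" "y \<in> Y" by blast
  then have "X \<subseteq> Y \<or> Y \<subseteq> X" using assms(2) unfolding subset.chain_def by blast
  then show "x - y \<in> \<Union>\<C>" using XY left_ideal_diff[OF assms(3)] by blast
next
  fix b x assume "b \<in> B" "x \<in> \<Union>\<C>"
  then show "b * x \<in> \<Union>\<C>" using left_ideal_mult[OF assms(3)] by blast
qed

definition ideal_sum :: "'r::ring set \<Rightarrow> 'r set \<Rightarrow> 'r set" where
  "ideal_sum I J = {x + y |x y. x \<in> I \<and> y \<in> J}"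

locale finite_over_center =
  fixes B C :: "'b::ring set" and u :: 'b and e :: "nat \<Rightarrow> 'b" and d :: nat
  assumes B_diff: "x \<in> B \<Longrightarrow> y \<in> B \<Longrightarrow> x - y \<in> B"
    and B_mult: "x \<in> B \<Longrightarrow> y \<in> B \<Longrightarrow> x * y \<in> B"
    and C_diff: "x \<in> C \<Longrightarrow> y \<in> C \<Longrightarrow> x - y \<in> C"
    and C_mult: "x \<in> C \<Longrightarrow> y \<in> C \<Longrightarrow> x * y \<in> C"
    and C_subset: "C \<subseteq> B"
    and unit_closed: "u \<in> C"
    and unit_left: "x \<in> B \<Longrightarrow> u * x = x"
    and unit_right: "x \<in> B \<Longrightarrow> x * u = x"
    and central: "z \<in> C \<Longrightarrow> x \<in> B \<Longrightarrow> z * x = x * z"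
    and gen_closed: "i < d \<Longrightarrow> e i \<in> B"
    and generated: "x \<in> B \<Longrightarrow> \<exists>z. (\<forall>i<d. z i \<in> C) \<and> x = (\<Sum>i<d. z i * e i)"
begin

lemma unit_B: "u \<in> B" using unit_closed C_subset by blast

lemma C_B: "z \<in> C \<Longrightarrow> z \<in> B" using C_subset by blast

lemma left_ideal_B: "left_ideal B B"
  unfolding left_ideal_def using B_diff[OF unit_B unit_B] B_diff B_mult by auto

lemma left_ideal_C: "left_ideal C C"
  unfolding left_ideal_def using C_diff[OF unit_closed unit_closed] C_diff C_mult by auto

lemmas B_zero = left_ideal_zero[OF left_ideal_B]
lemmas B_add = left_ideal_add[OF left_ideal_B]
lemmas C_add = left_ideal_add[OF left_ideal_C]

lemma left_ideal_mult_C: "left_ideal B I \<Longrightarrow> z \<in> C \<Longrightarrow> x \<in> I \<Longrightarrow> z * x \<in> I"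
  using left_ideal_mult C_B by blast

lemma left_ideal_in_B: "left_ideal B I \<Longrightarrow> x \<in> I \<Longrightarrow> x \<in> B"
  using left_ideal_subset by blast

lemma unit_in_left_ideal:
  assumes I: "left_ideal B I" and u: "u \<in> I"
  shows "I = B"
proof
  show "I \<subseteq> B" by (rule left_ideal_subset[OF I])
  show "B \<subseteq> I"
  proof
    fix x assume "x \<in> B"
    then show "x \<in> I" using left_ideal_mult[OF I _ u] unit_right by metis
  qed
qed

lemma ex_maximal_left_ideal:
  assumes L: "left_ideal B L" "u \<notin> L"
  shows "\<exists>M. maximal_left_ideal B M \<and> L \<subseteq> M"
proof -
  let ?A = "{J. left_ideal B J \<and> L \<subseteq> J \<and> u \<notin> J}"
  have "\<exists>M\<in>?A. \<forall>X\<in>?A. M \<subseteq> X \<longrightarrow> X = M"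
  proof (rule subset_Zorn_nonempty)
    show "?A \<noteq> {}" using L by blast
    fix \<C> assume c: "\<C> \<noteq> {}" "subset.chain ?A \<C>"
    then have sub: "\<C> \<subseteq> ?A" unfolding subset.chain_def by blast
    have "left_ideal B (\<Union>\<C>)" by (rule left_ideal_Union_chain[OF c]) (use sub in blast)
    moreover have "u \<notin> \<Union>\<C>" using sub by blast
    moreover obtain X where "X \<in> \<C>" using c(1) by blast
    then have "L \<subseteq> \<Union>\<C>" using sub by blast
    ultimately show "\<Union>\<C> \<in> ?A" by simp
  qed
  then obtain M where "M \<in> ?A" and "\<forall>X\<in>?A. M \<subseteq> X \<longrightarrow> X = M" ..
  then have M: "left_ideal B M" "L \<subseteq> M" "u \<notin> M"
    and max: "\<And>X. left_ideal B X \<Longrightarrow> L \<subseteq> X \<Longrightarrow> u \<notin> X \<Longrightarrow> M \<subseteq> X \<Longrightarrow> X = M" by simp_all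
  have "J = M \<or> J = B" if J: "left_ideal B J" "M \<subseteq> J" for J
  proof (cases "u \<in> J")
    case True
    then show ?thesis using unit_in_left_ideal[OF J(1)] by simp
  next
    case False
    have "L \<subseteq> J" using M(2) J(2) by (rule order_trans)
    from max[OF J(1) this False J(2)] show ?thesis ..
  qed
  moreover have "M \<noteq> B" using M(3) unit_B by auto
  ultimately have "maximal_left_ideal B M"
    unfolding maximal_left_ideal_def using M(1) by simp
  then show ?thesis using M(2) by auto
qed

lemma left_ideal_sum_ideals:
  assumes I: "left_ideal B I" and J: "left_ideal B J"
  shows "left_ideal B (ideal_sum I J)"
  unfolding left_ideal_def
proof (intro conjI ballI)
  show "ideal_sum I J \<subseteq> B"
    unfolding ideal_sum_def
    by (auto intro: B_add[OF left_ideal_in_B[OF I] left_ideal_in_B[OF J]])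
  have "0 = 0 + (0 :: 'b)" by simp
  then show "0 \<in> ideal_sum I J"
    unfolding ideal_sum_def using left_ideal_zero[OF I] left_ideal_zero[OF J] by blast
next
  fix a b assume "a \<in> ideal_sum I J" "b \<in> ideal_sum I J"
  then obtain x y x' y' where *: "a = x + y" "b = x' + y'" "x \<in> I" "x' \<in> I" "y \<in> J" "y' \<in> J"
    unfolding ideal_sum_def by blast
  then have "a - b = (x - x') + (y - y')" by simp
  then show "a - b \<in> ideal_sum I J"
    unfolding ideal_sum_def using left_ideal_diff[OF I *(3,4)] left_ideal_diff[OF J *(5,6)] by blast
next
  fix b a assume b: "b \<in> B" and "a \<in> ideal_sum I J"
  then obtain x y where *: "a = x + y" "x \<in> I" "y \<in> J" unfolding ideal_sum_def by blast
  then have "b * a = b * x + b * y" by (simp add: distrib_left)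
  then show "b * a \<in> ideal_sum I J"
    unfolding ideal_sum_def using left_ideal_mult[OF I b *(2)] left_ideal_mult[OF J b *(3)] by blast
qed

lemma ideal_sum_upper1: "left_ideal B J \<Longrightarrow> I \<subseteq> ideal_sum I J"
  unfolding ideal_sum_def using left_ideal_zero[of B J] by force

lemma ideal_sum_upper2: "left_ideal B I \<Longrightarrow> J \<subseteq> ideal_sum I J"
  unfolding ideal_sum_def using left_ideal_zero[of B I] by force

definition principal :: "'b \<Rightarrow> 'b set" where
  "principal x = (\<lambda>b. b * x) ` B"

lemma left_ideal_principal: "x \<in> B \<Longrightarrow> left_ideal B (principal x)"
  unfolding left_ideal_def principal_def
proof (intro conjI ballI)
  assume x: "x \<in> B"
  show "(\<lambda>b. b * x) ` B \<subseteq> B" using x B_mult by blast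
  show "0 \<in> (\<lambda>b. b * x) ` B" using B_zero by (intro image_eqI[of _ _ 0]) auto
  fix a b assume "a \<in> (\<lambda>b. b * x) ` B" "b \<in> (\<lambda>b. b * x) ` B"
  then obtain a' b' where "a = a' * x" "b = b' * x" "a' \<in> B" "b' \<in> B" by blast
  then show "a - b \<in> (\<lambda>b. b * x) ` B"
    using B_diff by (intro image_eqI[of _ _ "a' - b'"]) (auto simp: left_diff_distrib)
next
  fix b a assume b: "b \<in> B" and "a \<in> (\<lambda>b. b * x) ` B"
  then obtain a' where "a = a' * x" "a' \<in> B" by blast
  then show "b * a \<in> (\<lambda>b. b * x) ` B"
    using B_mult b by (intro image_eqI[of _ _ "b * a'"]) (auto simp: mult.assoc)
qed

lemma in_principal: "x \<in> B \<Longrightarrow> x \<in> principal x"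
  unfolding principal_def using unit_B unit_left by force

text \<open>The annihilator of the class of \<open>a\<close> in the module \<open>B / I\<close>;
  thus \<open>B / colon I a\<close> is the submodule generated by that class.\<close>

definition colon :: "'b set \<Rightarrow> 'b \<Rightarrow> 'b set" where
  "colon I a = {x \<in> B. x * a \<in> I}"

lemma left_ideal_colon:
  assumes "left_ideal B I"
  shows "left_ideal B (colon I a)"
  unfolding left_ideal_def colon_def
  using left_ideal_zero[OF assms] left_ideal_diff[OF assms] left_ideal_mult[OF assms] B_diff B_mult B_zero
  by (auto simp: left_diff_distrib mult.assoc)

text \<open>The two-sided ideal \<open>m B\<close> when \<open>m\<close> is an ideal of
  \<open>C\<close>. Writing it through the fixed generators keeps coefficients in \<open>m\<close>
  at hand for the elimination in \<open>nakayama\<close>.\<close>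

definition extension :: "'b set \<Rightarrow> 'b set" where
  "extension m = {\<Sum>i<d. z i * e i |z. \<forall>i<d. z i \<in> m}"

lemma extension_zero: "left_ideal C m \<Longrightarrow> 0 \<in> extension m"
  unfolding extension_def using left_ideal_zero[of C m]
  by (intro CollectI exI[of _ "\<lambda>_. 0"]) auto

lemma extension_add:
  assumes m: "left_ideal C m" and "x \<in> extension m" "y \<in> extension m"
  shows "x + y \<in> extension m"
proof -
  obtain z z' where "x = (\<Sum>i<d. z i * e i)" "y = (\<Sum>i<d. z' i * e i)"
      "\<forall>i<d. z i \<in> m" "\<forall>i<d. z' i \<in> m"
    using assms unfolding extension_def by blast
  then show ?thesis unfolding extension_def using left_ideal_add[OF m]
    by (intro CollectI exI[of _ "\<lambda>i. z i + z' i"]) (auto simp: distrib_right sum.distrib)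
qed

lemma extension_sum:
  assumes m: "left_ideal C m" and "\<And>i. i \<in> A \<Longrightarrow> f i \<in> extension m"
  shows "sum f A \<in> extension m"
  using assms(2) by (induction A rule: infinite_finite_induct)
    (auto intro: extension_zero[OF m] extension_add[OF m])

lemma extension_mult:
  assumes m: "left_ideal C m" and z: "z \<in> m" and x: "x \<in> B"
  shows "z * x \<in> extension m"
proof -
  obtain c where c: "\<forall>i<d. c i \<in> C" "x = (\<Sum>i<d. c i * e i)" using generated x by blast
  have "c i * z \<in> m" if "i < d" for i using left_ideal_mult[OF m _ z] c that by blast
  moreover have "z * c i = c i * z" if "i < d" for i
    using central[of "c i" z] c that z left_ideal_subset[OF m] C_subset by auto
  ultimately have "\<forall>i<d. z * c i \<in> m" by auto
  then show ?thesis unfolding extension_def c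
    by (intro CollectI exI[of _ "\<lambda>i. z * c i"]) (auto simp: sum_distrib_left mult.assoc)
qed

lemma left_ideal_extension:
  assumes m: "left_ideal C m"
  shows "left_ideal B (extension m)"
  unfolding left_ideal_def
proof (intro conjI ballI)
  have mB: "z \<in> B" if "z \<in> m" for z using that left_ideal_subset[OF m] C_subset by blast
  show sub: "extension m \<subseteq> B"
    unfolding extension_def using mB gen_closed
    by (auto intro!: left_ideal_sum[OF left_ideal_B] B_mult)
  show "0 \<in> extension m" by (rule extension_zero[OF m])
  have bx: "b * x \<in> extension m" if b: "b \<in> B" and x: "x \<in> extension m" for b x
  proof -
    obtain z where z: "x = (\<Sum>i<d. z i * e i)" "\<forall>i<d. z i \<in> m"
      using x unfolding extension_def by blast
    have "b * (z i * e i) = z i * (b * e i)" if "i < d" for i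
    proof -
      have "z i \<in> C" using z that left_ideal_subset[OF m] by blast
      then show ?thesis using central[of "z i" b] b by (simp only: mult.assoc[symmetric])
    qed
    then have "b * x = (\<Sum>i<d. z i * (b * e i))" unfolding z by (simp add: sum_distrib_left)
    also have "\<dots> \<in> extension m"
      using z b gen_closed by (intro extension_sum[OF m] extension_mult[OF m] B_mult) auto
    finally show ?thesis .
  qed
  show "b * x \<in> extension m" if "b \<in> B" "x \<in> extension m" for b x using bx that .
  fix x y assume x: "x \<in> extension m" and y: "y \<in> extension m"
  have "0 - u \<in> B" using B_diff B_zero unit_B by blast
  from bx[OF this y] have "- (u * y) \<in> extension m" by simp
  then have "- y \<in> extension m" using unit_left y sub by auto
  from extension_add[OF m x this] show "x - y \<in> extension m" by simp
qed

lemma extension_right: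
  assumes m: "left_ideal C m" and b: "b \<in> B" and x: "x \<in> extension m"
  shows "x * b \<in> extension m"
proof -
  obtain z where z: "x = (\<Sum>i<d. z i * e i)" "\<forall>i<d. z i \<in> m"
    using x unfolding extension_def by blast
  have "x * b = (\<Sum>i<d. z i * (e i * b))" unfolding z by (simp add: sum_distrib_right mult.assoc)
  also have "\<dots> \<in> extension m"
    using z b gen_closed by (intro extension_sum[OF m] extension_mult[OF m] B_mult) auto
  finally show ?thesis .
qed

lemma subset_extension:
  assumes "left_ideal C m"
  shows "m \<subseteq> extension m"
proof
  fix z assume z: "z \<in> m"
  then have "z \<in> B" using left_ideal_subset[OF assms] C_subset by blast
  then have "z * u = z" by (rule unit_right)
  then show "z \<in> extension m" using extension_mult[OF assms z unit_B] by simp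
qed

text \<open>In place of a determinant, the generators are eliminated one by one from the last to the
  first, at the cost of a multiplier that stays congruent to \<open>u\<close> modulo
  \<open>m\<close>. In the end the multiplier sends all of \<open>B\<close> into \<open>M\<close>,
  in particular the unit.\<close>

lemma nakayama:
  assumes M: "left_ideal B M" and m: "left_ideal C m" and u: "u \<in> ideal_sum M (extension m)"
  shows "\<exists>r\<in>C. r - u \<in> m \<and> r \<in> M"
proof -
  define P where "P = (\<lambda>k. \<exists>r\<in>C. r - u \<in> m \<and>
      (\<forall>x\<in>B. \<exists>z. (\<forall>i<k. z i \<in> C) \<and> r * x - (\<Sum>i<k. z i * e i) \<in> M))"
  have mC: "z \<in> C" if "z \<in> m" for z using that left_ideal_subset[OF m] by blast
  have all: "\<exists>z. (\<forall>i<d. z i \<in> m) \<and> x - (\<Sum>i<d. z i * e i) \<in> M" if "x \<in> B" for x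
  proof -
    have S: "left_ideal B (ideal_sum M (extension m))"
      by (intro left_ideal_sum_ideals M left_ideal_extension m)
    have "x \<in> ideal_sum M (extension m)" using unit_in_left_ideal[OF S u] that by blast
    then obtain y h where y: "x = y + h" "y \<in> M" "h \<in> extension m"
      unfolding ideal_sum_def by blast
    then obtain z where z: "h = (\<Sum>i<d. z i * e i)" "\<forall>i<d. z i \<in> m"
      unfolding extension_def by blast
    have "x - h \<in> M" using y by simp
    then show ?thesis using z by blast
  qed
  have step: "P k" if k: "k < d" and "P (Suc k)" for k
  proof -
    obtain r where r: "r \<in> C" "r - u \<in> m"
      and red: "\<And>x. x \<in> B \<Longrightarrow> \<exists>z. (\<forall>i<Suc k. z i \<in> C) \<and> r * x - (\<Sum>i<Suc k. z i * e i) \<in> M"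
      using \<open>P (Suc k)\<close> unfolding P_def by blast
    obtain c where c: "\<forall>i<d. c i \<in> m" "e k - (\<Sum>i<d. c i * e i) \<in> M"
      using all[OF gen_closed[OF k]] by blast
    have "\<forall>i. \<exists>z. i < d \<longrightarrow> (\<forall>j<Suc k. z j \<in> C) \<and> r * e i - (\<Sum>j<Suc k. z j * e j) \<in> M"
      using red gen_closed by blast
    then obtain z where z: "\<And>i j. i < d \<Longrightarrow> j < Suc k \<Longrightarrow> z i j \<in> C"
      "\<And>i. i < d \<Longrightarrow> r * e i - (\<Sum>j<Suc k. z i j * e j) \<in> M" by metis
    \<comment> \<open>Modulo \<open>M\<close>, \<open>e k\<close> is the combination of the
      \<open>e i\<close> with coefficients \<open>c i \<in> m\<close>, and each
      \<open>r * e i\<close> reduces to the first \<open>Suc k\<close> generators. The composed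
      coefficients \<open>n j\<close> inherit membership in \<open>m\<close>.\<close>
    define n where "n j = (\<Sum>i<d. c i * z i j)" for j
    have n: "n j \<in> m" if "j < Suc k" for j unfolding n_def
    proof (intro left_ideal_sum[OF m])
      fix i assume "i \<in> {..<d}"
      then have i: "i < d" by simp
      have "z i j * c i \<in> m" using left_ideal_mult[OF m z(1)[OF i that]] c i by blast
      moreover have "z i j * c i = c i * z i j"
        using central[OF z(1)[OF i that]] c i mC C_B by blast
      ultimately show "c i * z i j \<in> m" by simp
    qed
    have telescope: "(a - b) + (b - c) = a - c" for a b c :: 'b by simp
    have rc: "r * (c i * e i) = c i * (r * e i)" if "i < d" for i
    proof -
      have "c i \<in> B" using c(1) that mC C_B by simp
      then show ?thesis using central[OF r(1), of "c i"] by (simp only: mult.assoc[symmetric])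
    qed
    have "r * (e k - (\<Sum>i<d. c i * e i)) + (\<Sum>i<d. c i * (r * e i - (\<Sum>j<Suc k. z i j * e j))) \<in> M"
      using r c mC z by (intro left_ideal_add[OF M] left_ideal_mult_C[OF M] left_ideal_sum[OF M]) auto
    moreover have "(\<Sum>i<d. c i * (r * e i - (\<Sum>j<Suc k. z i j * e j))) =
        (\<Sum>i<d. c i * (r * e i)) - (\<Sum>i<d. \<Sum>j<Suc k. c i * (z i j * e j))"
      by (simp only: right_diff_distrib sum_subtractf sum_distrib_left)
    moreover have "(\<Sum>i<d. \<Sum>j<Suc k. c i * (z i j * e j)) = (\<Sum>j<Suc k. n j * e j)"
      unfolding n_def by (subst sum.swap) (simp only: sum_distrib_right mult.assoc)
    moreover have "r * (e k - (\<Sum>i<d. c i * e i)) = r * e k - (\<Sum>i<d. c i * (r * e i))"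
      using rc by (simp add: right_diff_distrib sum_distrib_left)
    ultimately have "r * e k - (\<Sum>j<Suc k. n j * e j) \<in> M"
      by (simp only: telescope)
    \<comment> \<open>Moving the term with \<open>e k\<close> to the left solves for
      \<open>s * e k\<close> in terms of the earlier generators; \<open>s\<close> is still congruent
      to \<open>u\<close> because \<open>n k \<in> m\<close>.\<close>
    moreover define s where "s = r - n k"
    ultimately have ek: "s * e k - (\<Sum>j<k. n j * e j) \<in> M"
      by (simp only: left_diff_distrib sum.lessThan_Suc diff_diff_add add.commute)
    have s: "s \<in> C" unfolding s_def using C_diff r n mC by simp
    show ?thesis unfolding P_def
    \<comment> \<open>\<open>r\<close> carries \<open>x\<close> into the span of the first
      \<open>Suc k\<close> generators, and \<open>s\<close> then removes \<open>e k\<close>.\<close>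
    proof (intro bexI[of _ "s * r"] conjI ballI)
      show "s * r \<in> C" using C_mult s r by blast
      have "n k * r = r * n k" using central[OF r(1), of "n k"] n mC C_B by simp
      then have "s * r - u = r * (r - u) + (r * u - u) - r * n k"
        by (simp add: s_def left_diff_distrib right_diff_distrib)
      also have "r * u = r" using unit_right r C_B by blast
      also have "r * (r - u) + (r - u) - r * n k \<in> m"
        using left_ideal_mult[OF m r(1)] left_ideal_add[OF m] left_ideal_diff[OF m] r(2) n by simp
      finally show "s * r - u \<in> m" .
      fix x assume "x \<in> B"
      then obtain t where t: "\<forall>i<Suc k. t i \<in> C" "r * x - (\<Sum>i<Suc k. t i * e i) \<in> M" using red by blast
      have tk: "t k \<in> C" using t by simp
      have "s * (r * x - (\<Sum>i<Suc k. t i * e i)) + t k * (s * e k - (\<Sum>j<k. n j * e j)) \<in> M"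
        by (intro left_ideal_add[OF M] left_ideal_mult_C[OF M] s tk ek t)
      moreover have "s * (r * x - (\<Sum>i<Suc k. t i * e i)) =
          s * r * x - (\<Sum>i<k. s * t i * e i) - s * (t k * e k)"
        by (simp only: sum.lessThan_Suc right_diff_distrib distrib_left sum_distrib_left mult.assoc diff_diff_add)
      moreover have "t k * (s * e k - (\<Sum>j<k. n j * e j)) = s * (t k * e k) - (\<Sum>j<k. t k * n j * e j)"
      proof -
        have "t k * (s * e k) = s * (t k * e k)"
          using central[OF s C_B[OF tk]] by (simp only: mult.assoc[symmetric])
        then show ?thesis by (simp only: right_diff_distrib sum_distrib_left mult.assoc)
      qed
      ultimately have "s * r * x - (\<Sum>i<k. (s * t i + t k * n i) * e i) \<in> M"
        by (simp only: distrib_right sum.distrib telescope diff_diff_add[symmetric])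
      moreover have "\<forall>i<k. s * t i + t k * n i \<in> C"
        using C_add C_mult s t tk n mC by simp
      ultimately show "\<exists>z. (\<forall>i<k. z i \<in> C) \<and> s * r * x - (\<Sum>i<k. z i * e i) \<in> M"
        by (intro exI[of _ "\<lambda>i. s * t i + t k * n i"]) blast
    qed
  qed
  have "k \<le> d \<Longrightarrow> P k \<Longrightarrow> P 0" for k
    by (induction k) (use step in auto)
  moreover have "P d" unfolding P_def
  proof (intro bexI[of _ u] conjI ballI unit_closed)
    show "u - u \<in> m" using left_ideal_zero[OF m] by simp
    fix x assume "x \<in> B"
    then show "\<exists>z. (\<forall>i<d. z i \<in> C) \<and> u * x - (\<Sum>i<d. z i * e i) \<in> M"
      using generated[of x] unit_left[of x] left_ideal_zero[OF M] by force
  qed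
  ultimately have "P 0" by blast
  then obtain r where r: "r \<in> C" "r - u \<in> m" "\<forall>x\<in>B. r * x \<in> M" unfolding P_def by auto
  then have "r \<in> M" using unit_B unit_right[of r] C_B by metis
  then show ?thesis using r by blast
qed

text \<open>A one-sided form of lying over: the multiplier from \<open>nakayama\<close> would lie in
  \<open>M \<inter> C\<close>, hence in \<open>m\<close>, and be congruent to \<open>u\<close>
  modulo \<open>m\<close>.\<close>

lemma proper_sum_extension:
  assumes M: "left_ideal B M" and m: "left_ideal C m" and "M \<inter> C \<subseteq> m" "u \<notin> m"
  shows "u \<notin> ideal_sum M (extension m)"
proof
  assume "u \<in> ideal_sum M (extension m)"
  from nakayama[OF M m this] obtain r where r: "r \<in> C" "r - u \<in> m" "r \<in> M" by blast
  then have "r \<in> m" using assms by blast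
  then show False using left_ideal_cong[OF m r(2)] assms(4) by blast
qed

text \<open>Schur's lemma for the simple module \<open>B / M\<close>: a central element acts on it
  as zero or injectively. If \<open>y \<notin> M\<close>, then \<open>u = w + b * y\<close> with
  \<open>w \<in> M\<close>, and \<open>x = x * w + b * (x * y)\<close>.\<close>

lemma prime_maximal:
  assumes "maximal_left_ideal B M"
  shows "prime_in C u (M \<inter> C)"
proof -
  have M: "left_ideal B M" "M \<noteq> B" and max: "\<And>J. left_ideal B J \<Longrightarrow> M \<subseteq> J \<Longrightarrow> J = M \<or> J = B"
    using assms unfolding maximal_left_ideal_def by auto
  have u: "u \<notin> M" using unit_in_left_ideal M by blast
  have "x \<in> M" if x: "x \<in> C" and y: "y \<in> C" "x * y \<in> M" "y \<notin> M" for x y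
  proof -
    have yB: "y \<in> B" using y C_B by blast
    let ?J = "ideal_sum M (principal y)"
    have J: "left_ideal B ?J" by (intro left_ideal_sum_ideals M left_ideal_principal yB)
    have "M \<subseteq> ?J" by (rule ideal_sum_upper1[OF left_ideal_principal[OF yB]])
    moreover have "y \<in> ?J" using ideal_sum_upper2[OF M(1)] in_principal[OF yB] by blast
    ultimately have "u \<in> ?J" using max[OF J] y unit_B by blast
    then obtain w b where w: "u = w + b * y" "w \<in> M" "b \<in> B"
      unfolding ideal_sum_def principal_def by blast
    have "x = x * u" using unit_right x C_B by simp
    also have "\<dots> = x * w + b * (x * y)"
      using central[OF x w(3)] by (simp add: w(1) distrib_left mult.assoc[symmetric])
    also have "\<dots> \<in> M"
      using left_ideal_mult_C[OF M(1) x w(2)] left_ideal_mult[OF M(1) w(3) y(2)] left_ideal_add[OF M(1)] by blast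
    finally show ?thesis .
  qed
  moreover have "left_ideal C (M \<inter> C)"
    using M(1) left_ideal_C C_subset unfolding left_ideal_def by blast
  ultimately show ?thesis using u unfolding prime_in_def by blast
qed

text \<open>Separation with \<open>z = u\<close> yields an ideal of finite codimension above the
  prime \<open>M \<inter> C\<close>. Adding its extension keeps \<open>M\<close> proper, so by
  maximality it adds nothing.\<close>

lemma maximal_contains_extension:
  assumes sep: "finitely_separated scl C u" and max: "maximal_left_ideal B M"
  shows "\<exists>m. left_ideal C m \<and> finite_codimension scl C m \<and> extension m \<subseteq> M"
proof -
  have M: "left_ideal B M" "M \<noteq> B" using max unfolding maximal_left_ideal_def by auto
  have p: "prime_in C u (M \<inter> C)" by (rule prime_maximal[OF max])
  then have "u \<notin> M \<inter> C" unfolding prime_in_def by blast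
  then obtain m where m: "left_ideal C m" "M \<inter> C \<subseteq> m" "u \<notin> m" "finite_codimension scl C m"
    using sep p unit_closed unfolding finitely_separated_def by blast
  let ?J = "ideal_sum M (extension m)"
  have J: "left_ideal B ?J" by (intro left_ideal_sum_ideals M left_ideal_extension m)
  have "u \<notin> ?J" by (rule proper_sum_extension[OF M(1) m(1-3)])
  moreover have "M \<subseteq> ?J" by (rule ideal_sum_upper1[OF left_ideal_extension[OF m(1)]])
  ultimately have "?J = M" using max J unit_B unfolding maximal_left_ideal_def by blast
  then show ?thesis using ideal_sum_upper2[OF M(1), of "extension m"] m by blast
qed

text \<open>\<open>B / M\<close> is a quotient of \<open>B / m B\<close>, which is spanned over the
  field by the products of the \<open>e i\<close> with a spanning set of
  \<open>C / m\<close>.\<close>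

lemma finite_codimension_maximal:
  assumes "vector_space scl" and scl: "\<And>c x y. scl c (x * y) = scl c x * y"
    and sep: "finitely_separated scl C u" and M: "maximal_left_ideal B M"
  shows "finite_codimension scl B M"
proof -
  interpret vector_space scl by (rule assms(1))
  obtain m where m: "left_ideal C m" "finite_codimension scl C m" "extension m \<subseteq> M"
    using maximal_contains_extension[OF sep M] by blast
  obtain S where S: "finite S" "S \<subseteq> C" "\<forall>v\<in>C. \<exists>s\<in>span S. v - s \<in> m"
    using m(2) unfolding finite_codimension_def by blast
  let ?T = "(\<lambda>(s, i). s * e i) ` (S \<times> {..<d})"
  have span: "t * e i \<in> span ?T" if "t \<in> span S" "i < d" for t i
    using that(1)
  proof (induction rule: span_induct_alt)
    case base
    then show ?case by (simp add: span_zero)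
  next
    case (step c x z)
    have "x * e i \<in> span ?T" using step(1) that(2) by (intro span_base) auto
    then have "scl c (x * e i) + z * e i \<in> span ?T" using step by (intro span_add span_scale)
    then show ?case by (simp add: distrib_right scl)
  qed
  show ?thesis
    unfolding finite_codimension_def
  proof (intro exI[of _ ?T] conjI ballI)
    show "finite ?T" using S by blast
    show "?T \<subseteq> B" using S C_B gen_closed by (auto intro!: B_mult)
    fix v assume "v \<in> B"
    then obtain z where z: "\<forall>i<d. z i \<in> C" "v = (\<Sum>i<d. z i * e i)" using generated by blast
    have "\<forall>i. \<exists>s. i < d \<longrightarrow> s \<in> span S \<and> z i - s \<in> m" using z(1) S(3) by blast
    then obtain s where s: "\<And>i. i < d \<Longrightarrow> s i \<in> span S" "\<And>i. i < d \<Longrightarrow> z i - s i \<in> m" by metis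
    have "v - (\<Sum>i<d. s i * e i) = (\<Sum>i<d. (z i - s i) * e i)"
      unfolding z(2) by (simp add: left_diff_distrib sum_subtractf)
    also have "\<dots> \<in> extension m"
      unfolding extension_def using s(2) by (intro CollectI exI[of _ "\<lambda>i. z i - s i"]) simp
    finally have "v - (\<Sum>i<d. s i * e i) \<in> M" using m(3) by blast
    then show "\<exists>s\<in>span ?T. v - s \<in> M" using s(1) by (intro bexI[of _ "\<Sum>i<d. s i * e i"] span_sum span) auto
  qed
qed

end

section \<open>Localization at a prime of the center\<close>

locale finite_over_center_prime = finite_over_center B C u e d
  for B C :: "'b::ring set" and u :: 'b and e :: "nat \<Rightarrow> 'b" and d :: nat +
  fixes p :: "'b set"
  assumes prime: "prime_in C u p"
begin

lemma p_ideal: "left_ideal C p" and u_notin_p: "u \<notin> p"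
  and p_prime: "x \<in> C \<Longrightarrow> y \<in> C \<Longrightarrow> x * y \<in> p \<Longrightarrow> x \<in> p \<or> y \<in> p"
  using prime unfolding prime_in_def by auto

lemma p_C: "z \<in> p \<Longrightarrow> z \<in> C" using left_ideal_subset[OF p_ideal] by blast

lemma mult_notin_p: "x \<in> C - p \<Longrightarrow> y \<in> C - p \<Longrightarrow> x * y \<in> C - p"
  using p_prime C_mult by auto

lemma unit_compl: "u \<in> C - p" using unit_closed u_notin_p by simp

text \<open>Saturated left ideals correspond to left ideals of the localization of \<open>B\<close> at \<open>p\<close>.\<close>

definition saturated :: "'b set \<Rightarrow> bool" where
  "saturated L \<longleftrightarrow> left_ideal B L \<and> (\<forall>z\<in>C - p. \<forall>x\<in>B. z * x \<in> L \<longrightarrow> x \<in> L)"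

definition saturation :: "'b set \<Rightarrow> 'b set" where
  "saturation L = {x \<in> B. \<exists>z\<in>C - p. z * x \<in> L}"

lemma saturated_ideal: "saturated L \<Longrightarrow> left_ideal B L"
  unfolding saturated_def by simp

lemma saturatedD: "saturated L \<Longrightarrow> z \<in> C - p \<Longrightarrow> x \<in> B \<Longrightarrow> z * x \<in> L \<Longrightarrow> x \<in> L"
  unfolding saturated_def by simp

lemma saturated_B: "saturated B"
  unfolding saturated_def using left_ideal_B by simp

lemma saturation_upper:
  assumes L: "left_ideal B L"
  shows "L \<subseteq> saturation L"
proof
  fix x assume x: "x \<in> L"
  then have xB: "x \<in> B" by (rule left_ideal_in_B[OF L])
  then have "u * x \<in> L" using x unit_left by simp
  then show "x \<in> saturation L" unfolding saturation_def using xB unit_compl by blast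
qed

lemma saturated_saturation:
  assumes L: "left_ideal B L"
  shows "saturated (saturation L)"
  unfolding saturated_def left_ideal_def
proof (intro conjI ballI impI)
  show "saturation L \<subseteq> B" unfolding saturation_def by blast
  show "0 \<in> saturation L"
    using saturation_upper[OF L] left_ideal_zero[OF L] by blast
next
  fix x y assume "x \<in> saturation L" "y \<in> saturation L"
  then obtain z w where *: "x \<in> B" "y \<in> B" "z \<in> C - p" "w \<in> C - p" "z * x \<in> L" "w * y \<in> L"
    unfolding saturation_def by blast
  have "z * w * (x - y) = w * (z * x) - z * (w * y)"
    using central[of z w] * C_B by (simp add: right_diff_distrib mult.assoc[symmetric])
  also have "\<dots> \<in> L"
    by (intro left_ideal_diff[OF L] left_ideal_mult_C[OF L _ *(5)]
        left_ideal_mult_C[OF L _ *(6)]) (use * in auto)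
  finally show "x - y \<in> saturation L"
    unfolding saturation_def using B_diff * mult_notin_p[OF *(3,4)] by blast
next
  fix b x assume b: "b \<in> B" and "x \<in> saturation L"
  then obtain z where *: "x \<in> B" "z \<in> C - p" "z * x \<in> L" unfolding saturation_def by blast
  have "z * (b * x) = b * (z * x)" using central[of z b] * b by (simp add: mult.assoc[symmetric])
  also have "\<dots> \<in> L" using left_ideal_mult[OF L b *(3)] .
  finally show "b * x \<in> saturation L"
    unfolding saturation_def using B_mult[OF b *(1)] * by blast
next
  fix z x assume z: "z \<in> C - p" and x: "x \<in> B" and "z * x \<in> saturation L"
  then obtain w where w: "w \<in> C - p" "w * (z * x) \<in> L" unfolding saturation_def by blast
  then have "w * z * x \<in> L" by (simp add: mult.assoc)
  then show "x \<in> saturation L"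
    unfolding saturation_def using mult_notin_p[OF w(1) z] x by blast
qed

text \<open>\<open>pivots L\<close> records the leading positions of the elements of \<open>L\<close>; its cardinality plays
  the role of a dimension over the residue field at \<open>p\<close>.\<close>

definition pivots :: "'b set \<Rightarrow> nat set" where
  "pivots L = {j. j < d \<and> (\<exists>z. (\<forall>i\<le>j. z i \<in> C) \<and> z j \<notin> p \<and> (\<Sum>i\<le>j. z i * e i) \<in> L)}"

lemma finite_pivots: "finite (pivots L)" "card (pivots L) \<le> d"
proof -
  have sub: "pivots L \<subseteq> {..<d}" unfolding pivots_def by blast
  then show "finite (pivots L)" by (rule finite_subset) simp
  show "card (pivots L) \<le> d" using card_mono[OF _ sub] by simp
qed

lemma pivots_mono: "L \<subseteq> L' \<Longrightarrow> pivots L \<subseteq> pivots L'"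
  unfolding pivots_def by blast

text \<open>Gaussian elimination from the highest position. A leading term with coefficient in
  \<open>p\<close> is dropped because \<open>p B \<subseteq> L\<close>; otherwise
  cross-multiplication with an element of \<open>L\<close> having the same pivot cancels it, and
  saturation removes the multiplier.\<close>

lemma subset_if_pivots_subset:
  assumes L: "saturated L" and L': "left_ideal B L'" and pL: "extension p \<subseteq> L" and sub: "L \<subseteq> L'"
    and piv: "pivots L' \<subseteq> pivots L"
  shows "L' \<subseteq> L"
proof -
  note LL = saturated_ideal[OF L]
  have "k \<le> d \<Longrightarrow> (\<forall>i<k. z i \<in> C) \<Longrightarrow> (\<Sum>i<k. z i * e i) \<in> L' \<Longrightarrow> (\<Sum>i<k. z i * e i) \<in> L" for k z
  proof (induction k arbitrary: z)
    case 0
    then show ?case using left_ideal_zero[OF LL] by simp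
  next
    case (Suc k)
    have ek: "e k \<in> B" using Suc.prems gen_closed by simp
    have zk: "z k \<in> C" using Suc.prems by simp
    show ?case
    proof (cases "z k \<in> p")
      case True
      have t: "z k * e k \<in> L" using extension_mult[OF p_ideal True ek] pL by blast
      then have "(\<Sum>i<Suc k. z i * e i) - z k * e k \<in> L'"
        using left_ideal_diff[OF L' Suc.prems(3)] sub by blast
      then have "(\<Sum>i<k. z i * e i) \<in> L" using Suc by simp
      from left_ideal_add[OF LL this t] show ?thesis by simp
    next
      case False
      have "k \<in> pivots L'" unfolding pivots_def
        using Suc.prems False by (intro CollectI conjI exI[of _ z]) (auto simp: lessThan_Suc_atMost)
      then have "k \<in> pivots L" using piv by blast
      then obtain w where w: "\<forall>i\<le>k. w i \<in> C" "w k \<notin> p" "(\<Sum>i\<le>k. w i * e i) \<in> L"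
        unfolding pivots_def by blast
      have wk: "w k \<in> C" using w by simp
      let ?x = "\<Sum>i<Suc k. z i * e i" and ?y = "\<Sum>i<Suc k. w i * e i"
      have yL: "?y \<in> L" using w(3) by (simp only: lessThan_Suc_atMost)
      have c: "z k * w k = w k * z k" using central[OF zk C_B[OF wk]] .
      have eq: "w k * ?x - z k * ?y = (\<Sum>i<k. (w k * z i - z k * w i) * e i)"
      proof -
        have "w k * ?x - z k * ?y = (\<Sum>i<Suc k. (w k * z i - z k * w i) * e i)"
          by (simp only: sum_distrib_left left_diff_distrib sum_subtractf mult.assoc)
        also have "\<dots> = (\<Sum>i<k. (w k * z i - z k * w i) * e i)" using c by simp
        finally show ?thesis .
      qed
      have "w k * ?x - z k * ?y \<in> L'"
        using yL sub by (intro left_ideal_diff[OF L'] left_ideal_mult_C[OF L'] wk zk Suc.prems) blast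
      then have "(\<Sum>i<k. (w k * z i - z k * w i) * e i) \<in> L"
        using Suc.prems w(1) wk zk unfolding eq by (intro Suc.IH) (auto intro!: C_diff C_mult)
      then have "w k * ?x - z k * ?y \<in> L" unfolding eq .
      from left_ideal_add[OF LL this left_ideal_mult_C[OF LL zk yL]]
      have "w k * ?x \<in> L" by (simp only: diff_add_cancel)
      moreover have "?x \<in> B" using left_ideal_in_B[OF L' Suc.prems(3)] .
      ultimately show ?thesis using saturatedD[OF L, of "w k" ?x] wk w(2) by blast
    qed
  qed
  from this[of d] show ?thesis using generated left_ideal_in_B[OF L'] by blast
qed

text \<open>The substitute for finite length: strict chains of saturated left ideals above
  \<open>p B\<close> have at most \<open>d\<close> steps.\<close>

lemma card_pivots_less:
  assumes "saturated L" "left_ideal B L'" "extension p \<subseteq> L" "L \<subset> L'"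
  shows "card (pivots L) < card (pivots L')"
proof (rule psubset_card_mono[OF finite_pivots(1)])
  have "L \<subseteq> L'" "\<not> L' \<subseteq> L" using assms(4) by blast+
  then have "\<not> pivots L' \<subseteq> pivots L"
    using subset_if_pivots_subset[OF assms(1-3)] by blast
  then show "pivots L \<subset> pivots L'" using pivots_mono[OF \<open>L \<subseteq> L'\<close>] by blast
qed

text \<open>This says that the localization of \<open>L\<close> at \<open>p\<close> is a maximal left ideal.\<close>

definition loc_maximal :: "'b set \<Rightarrow> bool" where
  "loc_maximal L \<longleftrightarrow> saturated L \<and> u \<notin> L \<and> extension p \<subseteq> L \<and>
     (\<forall>x\<in>B - L. \<exists>z\<in>C - p. \<exists>b\<in>B. z - b * x \<in> L)"

lemma extension_colon:
  assumes "extension p \<subseteq> L" "x \<in> B"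
  shows "extension p \<subseteq> colon L x"
proof
  fix y assume y: "y \<in> extension p"
  then have "y \<in> B" by (rule left_ideal_in_B[OF left_ideal_extension[OF p_ideal]])
  moreover have "y * x \<in> L" using extension_right[OF p_ideal assms(2) y] assms(1) by blast
  ultimately show "y \<in> colon L x" unfolding colon_def by simp
qed

lemma saturated_colon:
  assumes "saturated L" "x \<in> B"
  shows "saturated (colon L x)"
  unfolding saturated_def
proof (intro conjI ballI impI)
  show "left_ideal B (colon L x)" by (rule left_ideal_colon[OF saturated_ideal[OF assms(1)]])
  fix z y assume *: "z \<in> C - p" "y \<in> B" "z * y \<in> colon L x"
  then have "z * (y * x) \<in> L" unfolding colon_def by (simp add: mult.assoc)
  then have "y * x \<in> L" by (rule saturatedD[OF assms(1) *(1) B_mult[OF *(2) assms(2)]])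
  then show "y \<in> colon L x" unfolding colon_def using *(2) by simp
qed

text \<open>Existence of a simple submodule after localization: a saturated left ideal
  \<open>X\<close> properly above \<open>L\<close> with fewest pivots is minimal, so any
  \<open>c\<close> in \<open>X\<close> outside \<open>L\<close> generates a simple module, whose
  annihilator is \<open>colon L c\<close>.\<close>

lemma ex_loc_maximal_colon:
  assumes L: "saturated L" "extension p \<subseteq> L" "u \<notin> L"
  shows "\<exists>c\<in>B - L. loc_maximal (colon L c)"
proof -
  define F where "F = (\<lambda>X. saturated X \<and> L \<subset> X)"
  note LL = saturated_ideal[OF L(1)]
  have "L \<noteq> B" using L(3) unit_B by auto
  then have "F B" unfolding F_def using saturated_B left_ideal_subset[OF LL] by auto
  then obtain X where X: "F X" and min: "\<And>Y. F Y \<Longrightarrow> card (pivots X) \<le> card (pivots Y)"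
    using ex_has_least_nat[of F B "\<lambda>X. card (pivots X)"] by auto
  have XX: "saturated X" "L \<subset> X" using X unfolding F_def by auto
  then obtain c where c: "c \<in> X" "c \<notin> L" by blast
  have cB: "c \<in> B" using left_ideal_in_B[OF saturated_ideal[OF XX(1)] c(1)] .
  have "\<exists>z\<in>C - p. \<exists>b\<in>B. z - b * x \<in> colon L c" if x: "x \<in> B - colon L c" for x
  proof -
    have xB: "x \<in> B" and xc: "x * c \<notin> L" using x unfolding colon_def by auto
    have xcB: "x * c \<in> B" using B_mult xB cB .
    \<comment> \<open>The saturation of \<open>L + B x c\<close> lies between \<open>L\<close> and
      \<open>X\<close> and differs from \<open>L\<close>, so by minimality it contains
      \<open>c\<close>.\<close>
    let ?N = "ideal_sum L (principal (x * c))"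
    have N: "left_ideal B ?N" by (intro left_ideal_sum_ideals LL left_ideal_principal xcB)
    let ?S = "saturation ?N"
    have S: "saturated ?S" by (rule saturated_saturation[OF N])
    have LS: "L \<subseteq> ?S"
      using ideal_sum_upper1[OF left_ideal_principal[OF xcB]] saturation_upper[OF N] by (rule order_trans)
    have "x * c \<in> ?S"
      using ideal_sum_upper2[OF LL, of "principal (x * c)"] in_principal[OF xcB] saturation_upper[OF N] by auto
    then have "F ?S" unfolding F_def using S LS xc by blast
    have "?S \<subseteq> X"
    proof
      fix y assume "y \<in> ?S"
      then obtain z l b where y: "y \<in> B" "z \<in> C - p" "z * y = l + b * (x * c)" "l \<in> L" "b \<in> B"
        unfolding saturation_def ideal_sum_def principal_def by blast
      have "l + b * (x * c) \<in> X"
        using XX y xB c(1) saturated_ideal[OF XX(1)]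
        by (intro left_ideal_add[OF saturated_ideal[OF XX(1)]] left_ideal_mult[OF saturated_ideal[OF XX(1)]]) auto
      then show "y \<in> X" using saturatedD[OF XX(1) y(2,1)] y(3) by simp
    qed
    moreover have "extension p \<subseteq> ?S" using L(2) LS by (rule order_trans)
    then have "\<not> ?S \<subset> X"
      using card_pivots_less[OF S saturated_ideal[OF XX(1)]] leD[OF min[OF \<open>F ?S\<close>]] by blast
    ultimately have "c \<in> ?S" using c(1) by (simp add: psubset_eq)
    then obtain z l b where y: "z \<in> C - p" "z * c = l + b * (x * c)" "l \<in> L" "b \<in> B"
      unfolding saturation_def ideal_sum_def principal_def by blast
    have "(z - b * x) * c = l" using y(2) by (simp add: left_diff_distrib mult.assoc)
    moreover have "z - b * x \<in> B" using y xB C_B by (intro B_diff B_mult) auto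
    ultimately show ?thesis using y unfolding colon_def by auto
  qed
  moreover have "u \<notin> colon L c" unfolding colon_def using c cB unit_left by simp
  ultimately have "loc_maximal (colon L c)"
    unfolding loc_maximal_def using saturated_colon[OF L(1) cB] extension_colon[OF L(2) cB] by simp
  then show ?thesis using c cB by blast
qed

text \<open>After localization \<open>B / L\<close> is simple, hence generated by the class of
  \<open>x\<close>, and so isomorphic to the quotient by the annihilator of that class.\<close>

lemma loc_maximal_colon:
  assumes L: "loc_maximal L" and x: "x \<in> B" "x \<notin> L"
  shows "loc_maximal (colon L x)"
proof -
  have sat: "saturated L" and pL: "extension p \<subseteq> L"
    and gen: "\<And>x. x \<in> B - L \<Longrightarrow> \<exists>z\<in>C - p. \<exists>b\<in>B. z - b * x \<in> L"
    using L unfolding loc_maximal_def by auto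
  have "\<exists>z\<in>C - p. \<exists>b\<in>B. z - b * y \<in> colon L x" if y: "y \<in> B - colon L x" for y
  proof -
    have "y * x \<in> B - L" using y x B_mult unfolding colon_def by auto
    then obtain z b where z: "z \<in> C - p" "b \<in> B" "z - b * (y * x) \<in> L" using gen by blast
    have "x * (z - b * (y * x)) \<in> L" using left_ideal_mult[OF saturated_ideal[OF sat] x(1) z(3)] .
    also have "x * (z - b * (y * x)) = (z - x * b * y) * x"
      using central[of z x] z x by (simp add: right_diff_distrib left_diff_distrib mult.assoc)
    finally have "z - x * b * y \<in> colon L x"
      unfolding colon_def using z x y C_B by (auto intro!: B_diff B_mult)
    then show ?thesis using z x B_mult by blast
  qed
  moreover have "u \<notin> colon L x" unfolding colon_def using x unit_left by simp
  ultimately show ?thesis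
    unfolding loc_maximal_def using saturated_colon[OF sat x(1)] extension_colon[OF pL x(1)] by simp
qed

lemma loc_maximal_ideal: "loc_maximal L \<Longrightarrow> left_ideal B L"
  unfolding loc_maximal_def using saturated_ideal by blast

lemma left_ideal_Inter:
  assumes "\<And>i. i \<in> T \<Longrightarrow> left_ideal B (L i)"
  shows "left_ideal B {x \<in> B. \<forall>i\<in>T. x \<in> L i}"
  unfolding left_ideal_def
  using assms left_ideal_zero left_ideal_diff left_ideal_mult B_zero B_diff B_mult by simp blast

text \<open>For an irredundant family the quotient by the intersection is, up to localization, a direct
  sum of simple modules. Each of them lies in \<open>M\<close> or, as \<open>M\<close> is maximal among the saturated left
  ideals avoiding \<open>a\<close>, in the saturation of \<open>M + B a\<close>, which is therefore the whole ring.\<close>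

lemma avoiding_maximal_irredundant:
  assumes fin: "finite T" and L: "\<And>i. i \<in> T \<Longrightarrow> loc_maximal (L i)"
    and M: "saturated M" and sub: "{x \<in> B. \<forall>i\<in>T. x \<in> L i} \<subseteq> M"
    and irr: "\<And>i. i \<in> T \<Longrightarrow> \<not> {x \<in> B. \<forall>j\<in>T - {i}. x \<in> L j} \<subseteq> L i"
    and a: "a \<in> B" "a \<notin> M" and max: "\<And>N. saturated N \<Longrightarrow> M \<subset> N \<Longrightarrow> a \<in> N"
  shows "\<exists>z\<in>C - p. \<exists>b\<in>B. z - b * a \<in> M"
proof -
  note MM = saturated_ideal[OF M]
  have LI: "left_ideal B (L i)" if "i \<in> T" for i using loc_maximal_ideal[OF L[OF that]] .
  have inM: "x \<in> M" if "x \<in> B" "\<And>i. i \<in> T \<Longrightarrow> x \<in> L i" for x using sub that by blast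
  let ?N = "ideal_sum M (principal a)"
  have N: "left_ideal B ?N" by (intro left_ideal_sum_ideals MM left_ideal_principal a)
  \<comment> \<open>The claim amounts to \<open>u \<in> G\<close>; to get there, each summand is
    shown to lie in \<open>G\<close>.\<close>
  define G where "G = saturation ?N"
  have G: "saturated G" unfolding G_def by (rule saturated_saturation[OF N])
  note GG = saturated_ideal[OF G]
  have NG: "?N \<subseteq> G" unfolding G_def by (rule saturation_upper[OF N])
  have MN: "M \<subseteq> ?N" by (rule ideal_sum_upper1[OF left_ideal_principal[OF a(1)]])
  have aN: "a \<in> ?N" using ideal_sum_upper2[OF MM, of "principal a"] in_principal[OF a(1)] by blast
  \<comment> \<open>Such an \<open>x\<close> represents an element of the \<open>i\<close>-th
    summand, as it vanishes in all others.\<close>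
  have comp_in_G: "x \<in> G" if i: "i \<in> T" and x: "x \<in> B" "\<And>j. j \<in> T - {i} \<Longrightarrow> x \<in> L j" for i x
  proof (cases "x \<in> M")
    case True
    then show ?thesis using MN NG by blast
  next
    case False
    let ?K = "ideal_sum M (principal x)"
    have K: "left_ideal B ?K" by (intro left_ideal_sum_ideals MM left_ideal_principal x)
    have "M \<subseteq> saturation ?K"
      using ideal_sum_upper1[OF left_ideal_principal[OF x(1)]] saturation_upper[OF K] by (rule order_trans)
    moreover have "x \<in> saturation ?K"
      using ideal_sum_upper2[OF MM, of "principal x"] in_principal[OF x(1)] saturation_upper[OF K] by auto
    ultimately have "a \<in> saturation ?K" using max[OF saturated_saturation[OF K]] False by blast
    then obtain y m b where y: "y \<in> C - p" "y * a = m + b * x" "m \<in> M" "b \<in> B"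
      unfolding saturation_def ideal_sum_def principal_def by blast
    let ?x = "b * x"
    have xB: "?x \<in> B" using B_mult y x by blast
    have "?x \<notin> M"
    proof
      assume "?x \<in> M"
      then have "y * a \<in> M" using y left_ideal_add[OF MM] by simp
      then show False using saturatedD[OF M y(1) a(1)] a(2) by blast
    qed
    moreover have xL: "?x \<in> L j" if "j \<in> T - {i}" for j
      using left_ideal_mult[OF LI y(4) x(2)[OF that]] that by blast
    ultimately have "?x \<notin> L i" using inM[OF xB] by blast
    then obtain w c where w: "w \<in> C - p" "c \<in> B" "w - c * ?x \<in> L i"
      using L[OF i] xB unfolding loc_maximal_def by blast
    have "w * x = x * w" using central[of w x] w x by simp
    \<comment> \<open>\<open>w * x\<close> and \<open>x * c * ?x\<close> agree modulo every
      \<open>L j\<close>: modulo \<open>L i\<close> by the choice of \<open>c\<close>, modulo the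
      others because both vanish. So they agree modulo \<open>M\<close>, and since \<open>?x\<close>
      lies in \<open>M + B a\<close>, so does \<open>w * x\<close>.\<close>
    then have eq: "w * x - x * c * ?x = x * (w - c * ?x)"
      by (simp add: right_diff_distrib mult.assoc)
    have xc: "x * c \<in> B" using B_mult x w by blast
    have "w * x - x * c * ?x \<in> L j" if j: "j \<in> T" for j
    proof (cases "j = i")
      case True
      then show ?thesis unfolding eq using left_ideal_mult[OF LI[OF i] x(1) w(3)] by simp
    next
      case False
      then have ji: "j \<in> T - {i}" using j by simp
      have wC: "w \<in> C" using w(1) by simp
      show ?thesis
        by (rule left_ideal_diff[OF LI[OF j] left_ideal_mult_C[OF LI[OF j] wC x(2)[OF ji]]
              left_ideal_mult[OF LI[OF j] xc xL[OF ji]]])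
    qed
    moreover have "w * x - x * c * ?x \<in> B"
      using w x C_B by (intro B_diff B_mult[OF xc xB] B_mult[of w x]) auto
    ultimately have "w * x - x * c * ?x \<in> M" by (intro inM)
    then have "w * x - x * c * ?x \<in> ?N" using MN by blast
    moreover have "?x \<in> ?N"
    proof -
      have "?x = y * a - m" using y by simp
      also have "\<dots> \<in> ?N" using y MN aN by (intro left_ideal_diff[OF N] left_ideal_mult_C[OF N]) auto
      finally show ?thesis .
    qed
    then have "x * c * ?x \<in> ?N" by (rule left_ideal_mult[OF N xc])
    ultimately have "w * x - x * c * ?x + x * c * ?x \<in> ?N" by (rule left_ideal_add[OF N])
    then have "w * x \<in> ?N" by simp
    then show ?thesis unfolding G_def saturation_def using w x by blast
  qed
  \<comment> \<open>By irredundance the \<open>i\<close>-th summand is nonzero, and by simplicity it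
    contains the image of the unit up to a denominator \<open>z\<close>.\<close>
  have comp: "\<exists>z\<in>C - p. \<exists>x\<in>B. (\<forall>j\<in>T - {i}. x \<in> L j) \<and> z - x \<in> L i" if i: "i \<in> T" for i
  proof -
    obtain y where y: "y \<in> B" "\<forall>j\<in>T - {i}. y \<in> L j" "y \<notin> L i" using irr[OF i] by blast
    then obtain z b where z: "z \<in> C - p" "b \<in> B" "z - b * y \<in> L i"
      using L[OF i] unfolding loc_maximal_def by blast
    have "b * y \<in> L j" if "j \<in> T - {i}" for j using left_ideal_mult[OF LI z(2)] y that by blast
    then show ?thesis using z B_mult[OF z(2) y(1)] by blast
  qed
  \<comment> \<open>Chinese remaindering with a common denominator \<open>z\<close>. For
    \<open>S = T\<close> the element \<open>x\<close> of \<open>G\<close> agrees with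
    \<open>z\<close> modulo all \<open>L j\<close>, hence modulo \<open>M\<close>, so
    \<open>z\<close> itself lies in \<open>G\<close>.\<close>
  have "\<exists>z\<in>C - p. \<exists>x\<in>G. (\<forall>j\<in>T - S. x \<in> L j) \<and> (\<forall>j\<in>S. z - x \<in> L j)" if "S \<subseteq> T" for S
    using finite_subset[OF that fin] that
  proof (induction S rule: finite_induct)
    case empty
    have "\<forall>j\<in>T. 0 \<in> L j" using left_ideal_zero[OF LI] by blast
    then show ?case using left_ideal_zero[OF GG] unit_compl by auto
  next
    case (insert i S)
    obtain z x where z: "z \<in> C - p" "x \<in> G" "\<And>j. j \<in> T - S \<Longrightarrow> x \<in> L j" "\<And>j. j \<in> S \<Longrightarrow> z - x \<in> L j"
      using insert by blast
    have i: "i \<in> T" using insert by blast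
    obtain w y where w: "w \<in> C - p" "y \<in> B" "\<And>j. j \<in> T - {i} \<Longrightarrow> y \<in> L j" "w - y \<in> L i"
      using comp[OF i] by blast
    have yG: "y \<in> G" by (rule comp_in_G[OF i w(2,3)])
    have zC: "z \<in> C" and wC: "w \<in> C" using z w by auto
    have zw: "z * w = w * z" using central[OF zC C_B[OF wC]] .
    let ?x = "w * x + z * y"
    show ?case
    proof (rule bexI[of _ "z * w"], rule bexI[of _ ?x], intro conjI ballI)
      show "z * w \<in> C - p" by (rule mult_notin_p[OF z(1) w(1)])
      show "?x \<in> G" by (intro left_ideal_add[OF GG] left_ideal_mult_C[OF GG] zC wC z(2) yG)
      fix j assume j: "j \<in> T - insert i S"
      then have jT: "j \<in> T" by blast
      show "?x \<in> L j"
        by (intro left_ideal_add[OF LI[OF jT]] left_ideal_mult_C[OF LI[OF jT]] zC wC z(3) w(3))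
           (use j in auto)
    next
      fix j assume j: "j \<in> insert i S"
      then have jT: "j \<in> T" using insert by blast
      show "z * w - ?x \<in> L j"
      proof (cases "j = i")
        case True
        have "z * w - ?x = z * (w - y) - w * x" by (simp add: right_diff_distrib)
        also have "\<dots> \<in> L j"
          by (rule left_ideal_diff[OF LI[OF jT] left_ideal_mult_C[OF LI[OF jT] zC]
                left_ideal_mult_C[OF LI[OF jT] wC z(3)]])
             (use True w(4) insert.hyps i in auto)
        finally show ?thesis .
      next
        case False
        have "z * w - ?x = w * (z - x) - z * y" unfolding zw by (simp add: right_diff_distrib)
        also have "\<dots> \<in> L j"
          by (rule left_ideal_diff[OF LI[OF jT] left_ideal_mult_C[OF LI[OF jT] wC z(4)]
                left_ideal_mult_C[OF LI[OF jT] zC w(3)]])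
             (use False j jT in auto)
        finally show ?thesis .
      qed
    qed
  qed
  from this[of T] obtain z x where z: "z \<in> C - p" "x \<in> G" "\<And>j. j \<in> T \<Longrightarrow> z - x \<in> L j" by blast
  have "z - x \<in> B" using z C_B left_ideal_in_B[OF GG] by (intro B_diff) auto
  then have "z - x \<in> M" using z(3) by (rule inM)
  then have "z - x \<in> G" using MN NG by blast
  from left_ideal_add[OF GG this z(2)] have "z * u \<in> G" using z C_B unit_right by simp
  then have "u \<in> G" using saturatedD[OF G z(1) unit_B] by blast
  then obtain w m b where w: "w \<in> C - p" "w * u = m + b * a" "m \<in> M" "b \<in> B"
    unfolding G_def saturation_def ideal_sum_def principal_def by blast
  have "w * u = w" using w C_B unit_right by simp
  then have "w - b * a = m" using w(2) by (simp add: diff_eq_eq)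
  then show ?thesis using w by blast
qed

text \<open>Dropping a redundant \<open>L i\<close> leaves the intersection unchanged, so induction
  on \<open>T\<close> reaches an irredundant family.\<close>

lemma avoiding_maximal:
  assumes fin: "finite T" and L: "\<And>i. i \<in> T \<Longrightarrow> loc_maximal (L i)"
    and M: "saturated M" and sub: "{x \<in> B. \<forall>i\<in>T. x \<in> L i} \<subseteq> M"
    and a: "a \<in> B" "a \<notin> M" and max: "\<And>N. saturated N \<Longrightarrow> M \<subset> N \<Longrightarrow> a \<in> N"
  shows "\<exists>z\<in>C - p. \<exists>b\<in>B. z - b * a \<in> M"
  using fin L sub
proof (induction T rule: finite_psubset_induct)
  case (psubset T)
  show ?case
  proof (cases "\<exists>i\<in>T. {x \<in> B. \<forall>j\<in>T - {i}. x \<in> L j} \<subseteq> L i")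
    case True
    then obtain i where i: "i \<in> T" "{x \<in> B. \<forall>j\<in>T - {i}. x \<in> L j} \<subseteq> L i" by blast
    show ?thesis
    proof (rule psubset.IH[of "T - {i}"])
      show "T - {i} \<subset> T" using i by blast
      show "\<And>j. j \<in> T - {i} \<Longrightarrow> loc_maximal (L j)" using psubset.prems(1) by blast
      show "{x \<in> B. \<forall>j\<in>T - {i}. x \<in> L j} \<subseteq> M"
      proof
        fix x assume x: "x \<in> {x \<in> B. \<forall>j\<in>T - {i}. x \<in> L j}"
        then have "x \<in> L i" using i(2) by blast
        then have "x \<in> {x \<in> B. \<forall>j\<in>T. x \<in> L j}" using x by auto
        then show "x \<in> M" using psubset.prems(2) by blast
      qed
    qed
  next
    case False
    show ?thesis
      by (rule avoiding_maximal_irredundant[OF psubset.hyps(1) psubset.prems(1) M psubset.prems(2) _ a max])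
         (use False in auto)
  qed
qed

end

section \<open>Semiprime left ideals and their separation from elements\<close>

context finite_over_center
begin

text \<open>Every \<open>x * b * x\<close> is a combination over \<open>C\<close> of the finitely
  many elements \<open>x * e i * x\<close>, and these already lie in a single member of the
  chain.\<close>

lemma semiprime_Union_chain:
  assumes c: "\<C> \<noteq> {}" "subset.chain A \<C>" and sp: "\<And>X. X \<in> \<C> \<Longrightarrow> semiprime_left_ideal B X"
  shows "semiprime_left_ideal B (\<Union>\<C>)"
  unfolding semiprime_left_ideal_def
proof (intro conjI ballI impI)
  have LI: "left_ideal B X" if "X \<in> \<C>" for X using sp[OF that] unfolding semiprime_left_ideal_def by blast
  show "left_ideal B (\<Union>\<C>)" by (rule left_ideal_Union_chain[OF c LI])
  fix x assume x: "x \<in> B" and xBx: "(\<lambda>b. x * b * x) ` B \<subseteq> \<Union>\<C>"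
  have "(\<lambda>i. x * e i * x) ` {..<d} \<subseteq> \<Union>\<C>" using xBx gen_closed by blast
  then obtain X where X: "X \<in> \<C>" "(\<lambda>i. x * e i * x) ` {..<d} \<subseteq> X"
    using finite_subset_Union_chain[OF _ _ c] by (metis finite_imageI finite_lessThan)
  have "x * b * x \<in> X" if b: "b \<in> B" for b
  proof -
    obtain z where z: "\<forall>i<d. z i \<in> C" "b = (\<Sum>i<d. z i * e i)" using generated[OF b] by blast
    have "x * (z i * e i) * x = z i * (x * e i * x)" if "i < d" for i
      using central[of "z i" x] z that x by (simp add: mult.assoc[symmetric])
    then have "x * b * x = (\<Sum>i<d. z i * (x * e i * x))"
      unfolding z by (simp add: sum_distrib_left sum_distrib_right)
    also have "\<dots> \<in> X"
    proof (rule left_ideal_sum[OF LI[OF X(1)]])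
      fix i assume "i \<in> {..<d}"
      then show "z i * (x * e i * x) \<in> X"
        using left_ideal_mult_C[OF LI[OF X(1)], of "z i" "x * e i * x"] X(2) z(1) by blast
    qed
    finally show ?thesis .
  qed
  then have "x \<in> X" using sp[OF X(1)] x unfolding semiprime_left_ideal_def by blast
  then show "x \<in> \<Union>\<C>" using X by blast
qed

text \<open>Since \<open>z\<close> is central,
  \<open>z * x * b * (z * x) = z * (z * (x * b * x))\<close>, so semiprimeness of \<open>I\<close>
  applies to \<open>z * x\<close>.\<close>

lemma semiprime_central_colon:
  assumes I: "semiprime_left_ideal B I" and z: "z \<in> C"
  shows "semiprime_left_ideal B {x \<in> B. z * x \<in> I}"
proof -
  have LI: "left_ideal B I" and sp: "\<And>x. x \<in> B \<Longrightarrow> (\<And>b. b \<in> B \<Longrightarrow> x * b * x \<in> I) \<Longrightarrow> x \<in> I"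
    using I unfolding semiprime_left_ideal_def by auto
  have "{x \<in> B. z * x \<in> I} = colon I z"
    unfolding colon_def using central[OF z] by auto
  then have "left_ideal B {x \<in> B. z * x \<in> I}" using left_ideal_colon[OF LI] by simp
  moreover have "z * x \<in> I" if x: "x \<in> B" and xbx: "\<And>b. b \<in> B \<Longrightarrow> z * (x * b * x) \<in> I" for x
  proof (rule sp)
    show "z * x \<in> B" using B_mult C_B z x by blast
    fix b assume b: "b \<in> B"
    have e: "x * b * z = z * (x * b)" using central[OF z B_mult[OF x b]] by simp
    have "z * x * b * (z * x) = z * ((x * b * z) * x)" by (simp only: mult.assoc)
    also have "\<dots> = z * (z * (x * b * x))" unfolding e by (simp only: mult.assoc)
    finally show "z * x * b * (z * x) \<in> I" using left_ideal_mult_C[OF LI z xbx[OF b]] by simp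
  qed
  ultimately show ?thesis unfolding semiprime_left_ideal_def by auto
qed

text \<open>If \<open>z * a \<notin> J\<close>, the elements sent into \<open>J\<close> by
  \<open>z\<close> form a semiprime left ideal above \<open>J\<close> that still avoids
  \<open>a\<close>. Maximality makes it equal to \<open>J\<close>, which is the cancellation
  property.\<close>

lemma ex_maximal_semiprime:
  assumes I: "semiprime_left_ideal B I" and a: "a \<notin> I"
  shows "\<exists>J. semiprime_left_ideal B J \<and> I \<subseteq> J \<and> a \<notin> J \<and>
    (\<forall>z\<in>C. \<forall>x\<in>B. z * a \<notin> J \<longrightarrow> z * x \<in> J \<longrightarrow> x \<in> J)"
proof -
  let ?A = "{J. semiprime_left_ideal B J \<and> I \<subseteq> J \<and> a \<notin> J}"
  have "\<exists>M\<in>?A. \<forall>X\<in>?A. M \<subseteq> X \<longrightarrow> X = M"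
  proof (rule subset_Zorn_nonempty)
    show "?A \<noteq> {}" using I a by blast
    fix \<C> assume c: "\<C> \<noteq> {}" "subset.chain ?A \<C>"
    then have sub: "\<C> \<subseteq> ?A" unfolding subset.chain_def by blast
    have "semiprime_left_ideal B (\<Union>\<C>)" by (rule semiprime_Union_chain[OF c]) (use sub in blast)
    moreover have "a \<notin> \<Union>\<C>" using sub by blast
    moreover obtain X where "X \<in> \<C>" using c(1) by blast
    then have "I \<subseteq> \<Union>\<C>" using sub by blast
    ultimately show "\<Union>\<C> \<in> ?A" by simp
  qed
  then obtain J where "J \<in> ?A" and "\<forall>X\<in>?A. J \<subseteq> X \<longrightarrow> X = J" ..
  then have J: "semiprime_left_ideal B J" "I \<subseteq> J" "a \<notin> J"
    and max: "\<And>X. semiprime_left_ideal B X \<Longrightarrow> I \<subseteq> X \<Longrightarrow> a \<notin> X \<Longrightarrow> J \<subseteq> X \<Longrightarrow> X = J" by simp_all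
  have LJ: "left_ideal B J" using J unfolding semiprime_left_ideal_def by blast
  have "x \<in> J" if z: "z \<in> C" and x: "x \<in> B" "z * a \<notin> J" "z * x \<in> J" for z x
  proof -
    let ?X = "{x \<in> B. z * x \<in> J}"
    have JX: "J \<subseteq> ?X" using left_ideal_mult_C[OF LJ z] left_ideal_in_B[OF LJ] by blast
    have "?X = J"
    proof (rule max)
      show "semiprime_left_ideal B ?X" by (rule semiprime_central_colon[OF J(1) z])
      show "I \<subseteq> ?X" using J(2) JX by (rule order_trans)
      show "a \<notin> ?X" using x(2) by simp
    qed (rule JX)
    then show ?thesis using x by blast
  qed
  then show ?thesis using J by blast
qed

lemma separating_maximal_left_ideal:
  assumes sep: "finitely_separated scl C u"
    and I: "semiprime_left_ideal B I" and a: "a \<in> B" "a \<notin> I"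
    and satI: "\<And>z x. z \<in> C \<Longrightarrow> x \<in> B \<Longrightarrow> z * a \<notin> I \<Longrightarrow> z * x \<in> I \<Longrightarrow> x \<in> I"
  shows "\<exists>M. maximal_left_ideal B M \<and> I \<subseteq> M \<and> a \<notin> M"
proof -
  have LI: "left_ideal B I" and sp: "\<And>x. x \<in> B \<Longrightarrow> (\<And>b. b \<in> B \<Longrightarrow> x * b * x \<in> I) \<Longrightarrow> x \<in> I"
    using I unfolding semiprime_left_ideal_def by auto
  define p where "p = {z \<in> C. z * a \<in> I}"
  have "prime_in C u p"
    unfolding prime_in_def
  proof (intro conjI ballI impI)
    show "left_ideal C p"
      unfolding left_ideal_def p_def
      using left_ideal_zero[OF LI] left_ideal_diff[OF LI] left_ideal_mult_C[OF LI] C_diff C_mult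
        left_ideal_zero[OF left_ideal_C]
      by (auto simp: left_diff_distrib mult.assoc)
    show "u \<notin> p" unfolding p_def using a unit_left by simp
    fix x y assume xy: "x \<in> C" "y \<in> C" "x * y \<in> p"
    then have "x * (y * a) \<in> I" unfolding p_def by (simp add: mult.assoc)
    then have "x * a \<notin> I \<Longrightarrow> y * a \<in> I" using satI[of x "y * a"] xy B_mult[OF C_B a(1)] by blast
    then show "x \<in> p \<or> y \<in> p" unfolding p_def using xy by blast
  qed
  then interpret P: finite_over_center_prime B C u e d p by unfold_locales
  have satI': "P.saturated I" unfolding P.saturated_def using LI satI unfolding p_def by blast
  \<comment> \<open>Counting pivots requires left ideals above \<open>p B\<close>. \<open>I\<close>
    need not be one, but the annihilator of \<open>a\<close> modulo \<open>I\<close> is, because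
    \<open>p\<close> kills \<open>a\<close> modulo \<open>I\<close>.\<close>
  define La where "La = colon I a"
  have La: "P.saturated La" unfolding La_def by (rule P.saturated_colon[OF satI' a(1)])
  have pLa: "extension p \<subseteq> La"
  proof
    fix x assume x: "x \<in> extension p"
    then obtain z where z: "x = (\<Sum>i<d. z i * e i)" "\<forall>i<d. z i \<in> p" unfolding extension_def by blast
    have "z i * e i * a = e i * (z i * a)" if "i < d" for i
      using central[of "z i" "e i"] z that gen_closed P.p_C by (simp add: mult.assoc)
    then have "x * a = (\<Sum>i<d. e i * (z i * a))" unfolding z by (simp add: sum_distrib_right)
    also have "\<dots> \<in> I"
    proof (rule left_ideal_sum[OF LI])
      fix i assume "i \<in> {..<d}"
      then show "e i * (z i * a) \<in> I"
        using left_ideal_mult[OF LI gen_closed, of i "z i * a"] z(2) unfolding p_def by auto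
    qed
    finally show "x \<in> La"
      unfolding La_def colon_def using left_ideal_in_B[OF left_ideal_extension[OF P.p_ideal] x] by simp
  qed
  have "u \<notin> La" unfolding La_def colon_def using unit_left a by simp
  then obtain c where c: "c \<in> B" "c \<notin> La" "P.loc_maximal (colon La c)"
    using P.ex_loc_maximal_colon[OF La pLa] by blast
  define L0 where "L0 = colon La c"
  define a' where "a' = c * a"
  have a': "a' \<in> B" "a' \<notin> I" using c a B_mult unfolding a'_def La_def colon_def by auto
  have L0: "L0 = {x \<in> B. x * a' \<in> I}"
    unfolding L0_def La_def colon_def a'_def using B_mult c(1) by (auto simp: mult.assoc)
  have L0I: "left_ideal B L0" unfolding L0_def by (rule P.loc_maximal_ideal[OF c(3)])
  have pL0: "extension p \<subseteq> L0" unfolding L0_def by (rule P.extension_colon[OF pLa c(1)])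
  \<comment> \<open>\<open>Q\<close> is to annihilate \<open>B a'\<close> modulo \<open>I\<close>;
    as coefficients are central, it suffices to test the generators. Those with
    \<open>e i \<in> L0\<close> impose no condition, and their colon would be \<open>B\<close>
    instead of a maximal one.\<close>
  define T where "T = {i. i < d \<and> e i \<notin> L0}"
  define Q where "Q = {x \<in> B. \<forall>i\<in>T. x \<in> colon L0 (e i)}"
  have finT: "finite T" unfolding T_def by simp
  have maxT: "P.loc_maximal (colon L0 (e i))" if "i \<in> T" for i
    using that P.loc_maximal_colon[OF c(3)] gen_closed unfolding T_def L0_def[symmetric] by blast
  have QI: "left_ideal B Q"
    unfolding Q_def by (rule P.left_ideal_Inter) (rule left_ideal_colon[OF L0I])
  have Qmult: "q * b * a' \<in> I" if q: "q \<in> Q" and b: "b \<in> B" for q b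
  proof -
    have qB: "q \<in> B" using q unfolding Q_def by blast
    have qe: "q * e i \<in> L0" if "i < d" for i
    proof (cases "i \<in> T")
      case True
      then show ?thesis using q unfolding Q_def colon_def by blast
    next
      case False
      then show ?thesis using that left_ideal_mult[OF L0I qB] unfolding T_def by blast
    qed
    obtain z where z: "\<forall>i<d. z i \<in> C" "b = (\<Sum>i<d. z i * e i)" using generated[OF b] by blast
    have "q * (z i * e i) = z i * (q * e i)" if "i < d" for i
      using central[of "z i" q] z that qB by (simp add: mult.assoc[symmetric])
    then have "q * b = (\<Sum>i<d. z i * (q * e i))" unfolding z by (simp add: sum_distrib_left)
    also have "\<dots> \<in> L0"
      by (rule left_ideal_sum[OF L0I], rule left_ideal_mult_C[OF L0I _ qe]) (use z in auto)
    finally show ?thesis unfolding L0 by simp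
  qed
  have pQ: "extension p \<subseteq> Q"
    unfolding Q_def
    using P.extension_colon[OF pL0 gen_closed] left_ideal_in_B[OF left_ideal_extension[OF P.p_ideal]]
    unfolding T_def by blast
  let ?S = "ideal_sum I Q"
  have S: "left_ideal B ?S" by (intro left_ideal_sum_ideals LI QI)
  define N0 where "N0 = P.saturation ?S"
  have N0: "P.saturated N0" unfolding N0_def by (rule P.saturated_saturation[OF S])
  have SN0: "?S \<subseteq> N0" unfolding N0_def by (rule P.saturation_upper[OF S])
  have IN0: "I \<subseteq> N0" using ideal_sum_upper1[OF QI] SN0 by (rule order_trans)
  have QN0: "Q \<subseteq> N0" using ideal_sum_upper2[OF LI] SN0 by (rule order_trans)
  have "a' \<notin> N0"
  proof
    assume "a' \<in> N0"
    then obtain z i q where z: "z \<in> C - p" "z * a' = i + q" "i \<in> I" "q \<in> Q"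
      unfolding N0_def P.saturation_def ideal_sum_def by blast
    have zC: "z \<in> C" using z by blast
    \<comment> \<open>In \<open>q * b * q\<close> only the right factor is replaced by
      \<open>z * a' - i\<close>: the first part is handled by \<open>Qmult\<close> and centrality of
      \<open>z\<close>, the second by \<open>I\<close> being a left ideal.\<close>
    have "q \<in> I"
    proof (rule sp)
      show qB: "q \<in> B" by (rule left_ideal_in_B[OF QI z(4)])
      fix b assume b: "b \<in> B"
      have qb: "q * b \<in> B" by (rule B_mult[OF qB b])
      have q: "q = z * a' - i" using z(2) by simp
      have "q * b * (z * a') = z * (q * b * a')"
        using central[OF zC qb] by (simp add: mult.assoc[symmetric])
      then have "q * b * (z * a' - i) = z * (q * b * a') - q * b * i"
        by (simp only: right_diff_distrib)
      also have "\<dots> \<in> I"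
        by (intro left_ideal_diff[OF LI] left_ideal_mult_C[OF LI zC] Qmult z(4) b left_ideal_mult[OF LI qb] z(3))
      finally show "q * b * q \<in> I" using q by simp
    qed
    then have "z * a' \<in> I" using z left_ideal_add[OF LI] by simp
    then show False using P.saturatedD[OF satI' z(1) a'(1)] a'(2) by blast
  qed
  \<comment> \<open>A member with the most pivots is maximal, since every larger saturated left
    ideal has strictly more.\<close>
  define F where "F = (\<lambda>N. P.saturated N \<and> N0 \<subseteq> N \<and> a' \<notin> N)"
  have "F N0" unfolding F_def using N0 \<open>a' \<notin> N0\<close> by blast
  moreover have "\<forall>N. F N \<longrightarrow> card (P.pivots N) < Suc d"
    using P.finite_pivots(2) by (simp add: less_Suc_eq_le)
  ultimately have "\<exists>M. F M \<and> (\<forall>N. F N \<longrightarrow> card (P.pivots N) \<le> card (P.pivots M))"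
    by (rule Lattices_Big.ex_has_greatest_nat)
  then obtain M where M: "F M" and Mmax: "\<And>N. F N \<Longrightarrow> card (P.pivots N) \<le> card (P.pivots M)"
    by auto
  have satM: "P.saturated M" and N0M: "N0 \<subseteq> M" and aM: "a' \<notin> M" using M unfolding F_def by auto
  have MM: "left_ideal B M" by (rule P.saturated_ideal[OF satM])
  have pM: "extension p \<subseteq> M" using order_trans[OF pQ order_trans[OF QN0 N0M]] .
  have above: "a' \<in> N" if N: "P.saturated N" "M \<subset> N" for N
  proof (rule ccontr)
    assume "a' \<notin> N"
    then have "F N" unfolding F_def using N N0M by blast
    moreover have "card (P.pivots M) < card (P.pivots N)"
      by (rule P.card_pivots_less[OF satM P.saturated_ideal[OF N(1)] pM N(2)])
    ultimately show False using Mmax by (simp add: leD)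
  qed
  have "\<exists>z\<in>C - p. \<exists>b\<in>B. z - b * a' \<in> M"
    by (rule P.avoiding_maximal[where T = T and L = "\<lambda>i. colon L0 (e i)", OF finT maxT satM _ a'(1) aM above])
       (assumption | rule order_trans[OF QN0 N0M, unfolded Q_def])+
  then obtain z b where z: "z \<in> C - p" "b \<in> B" "z - b * a' \<in> M" by blast
  have zC: "z \<in> C" "z \<notin> p" using z by auto
  obtain m w where m: "left_ideal C m" "p \<subseteq> m" "u \<notin> m" "w \<in> C" "w * z - u \<in> m"
    using sep P.prime zC unfolding finitely_separated_def by blast
  \<comment> \<open>A proper saturated left ideal contains no element of \<open>C - p\<close>, so
    \<open>M\<close> meets \<open>C\<close> inside \<open>p\<close>.\<close>
  have "M \<inter> C \<subseteq> m"
  proof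
    fix y assume y: "y \<in> M \<inter> C"
    show "y \<in> m"
    proof (rule ccontr)
      assume "y \<notin> m"
      then have "y \<in> C - p" using y m(2) by blast
      moreover have "y * u \<in> M" using y unit_right C_B by simp
      ultimately have "u \<in> M" using P.saturatedD[OF satM] unit_B by blast
      then have "M = B" by (rule unit_in_left_ideal[OF MM])
      then show False using aM a'(1) by simp
    qed
  qed
  then have "u \<notin> ideal_sum M (extension m)" by (rule proper_sum_extension[OF MM m(1) _ m(3)])
  moreover have "left_ideal B (ideal_sum M (extension m))"
    by (intro left_ideal_sum_ideals MM left_ideal_extension m)
  ultimately obtain X where X: "maximal_left_ideal B X" "ideal_sum M (extension m) \<subseteq> X"
    using ex_maximal_left_ideal by blast
  have XI: "left_ideal B X" "X \<noteq> B" using X(1) unfolding maximal_left_ideal_def by auto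
  have MX: "M \<subseteq> X" using ideal_sum_upper1[OF left_ideal_extension[OF m(1)]] X(2) by (rule order_trans)
  have "extension m \<subseteq> X" using ideal_sum_upper2[OF MM] X(2) by (rule order_trans)
  then have mX: "m \<subseteq> X" using subset_extension[OF m(1)] by blast
  have "a \<notin> X"
  proof
    assume "a \<in> X"
    then have "b * a' \<in> X" unfolding a'_def by (intro left_ideal_mult[OF XI(1)] z c)
    moreover have "z - b * a' \<in> X" using z(3) MX by blast
    ultimately have "z \<in> X" using left_ideal_add[OF XI(1), of "z - b * a'" "b * a'"] by simp
    then have "w * z \<in> X" by (rule left_ideal_mult_C[OF XI(1) m(4)])
    moreover have "w * z - u \<in> X" using m(5) mX by blast
    ultimately have "u \<in> X" using left_ideal_cong[OF XI(1)] by blast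
    then show False using unit_in_left_ideal[OF XI(1)] XI(2) by blast
  qed
  moreover have "I \<subseteq> X" using IN0 N0M MX by blast
  ultimately show ?thesis using X(1) by blast
qed

lemma strongly_left_Jacobson_if_separated:
  assumes sep: "finitely_separated scl C u"
  shows "strongly_left_Jacobson B"
  unfolding strongly_left_Jacobson_def
proof (intro allI impI)
  fix I assume I: "semiprime_left_ideal B I"
  let ?M = "{M. maximal_left_ideal B M \<and> I \<subseteq> M}"
  have "a \<in> I" if a: "a \<in> B" "\<And>M. M \<in> ?M \<Longrightarrow> a \<in> M" for a
  proof (rule ccontr)
    assume "a \<notin> I"
    then obtain J where J: "semiprime_left_ideal B J" "I \<subseteq> J" "a \<notin> J"
      "\<And>z x. z \<in> C \<Longrightarrow> x \<in> B \<Longrightarrow> z * a \<notin> J \<Longrightarrow> z * x \<in> J \<Longrightarrow> x \<in> J"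
      using ex_maximal_semiprime[OF I] by blast
    obtain M where "maximal_left_ideal B M" "J \<subseteq> M" "a \<notin> M"
      using separating_maximal_left_ideal[OF sep J(1) a(1) J(3)] J(4) by metis
    then show False using a(2)[of M] J(2) by blast
  qed
  moreover have "I \<subseteq> B" using I left_ideal_subset unfolding semiprime_left_ideal_def by blast
  ultimately have "I = B \<inter> \<Inter> ?M" by auto
  then show "\<exists>\<M>. (\<forall>M\<in>\<M>. maximal_left_ideal B M) \<and> I = B \<inter> \<Inter> \<M>"
    by (intro exI[of _ ?M] conjI) auto
qed

end

section \<open>Polynomials over a finite-dimensional algebra\<close>

lemma poly_mapping_sum_single:
  "p = (\<Sum>m\<in>Poly_Mapping.keys p. Poly_Mapping.single m (Poly_Mapping.lookup p m))"
proof (rule poly_mapping_eqI)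
  fix k
  have "Poly_Mapping.lookup (\<Sum>m\<in>Poly_Mapping.keys p. Poly_Mapping.single m (Poly_Mapping.lookup p m)) k =
      (\<Sum>m\<in>Poly_Mapping.keys p. if m = k then Poly_Mapping.lookup p m else 0)"
    unfolding lookup_sum by (intro sum.cong) (auto simp: lookup_single when_def)
  also have "\<dots> = Poly_Mapping.lookup p k" by (auto simp: in_keys_iff)
  finally show "Poly_Mapping.lookup p k =
    Poly_Mapping.lookup (\<Sum>m\<in>Poly_Mapping.keys p. Poly_Mapping.single m (Poly_Mapping.lookup p m)) k" by simp
qed

lemma single_in_poly_ring: "Poly_Mapping.keys m \<subseteq> {..<n} \<Longrightarrow> Poly_Mapping.single m c \<in> poly_ring n"
  unfolding poly_ring_def by auto

lemma subring_of_poly_ring: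
  "subring_of (poly_ring n :: ((nat \<Rightarrow>\<^sub>0 nat) \<Rightarrow>\<^sub>0 'f::comm_ring_1) set)"
proof
  show "1 \<in> (poly_ring n :: ((nat \<Rightarrow>\<^sub>0 nat) \<Rightarrow>\<^sub>0 'f) set)" unfolding poly_ring_def by simp
qed (auto intro: diff_in_poly_ring mult_in_poly_ring)

abbreviation variable :: "nat \<Rightarrow> (nat \<Rightarrow>\<^sub>0 nat) \<Rightarrow>\<^sub>0 'f::comm_ring_1" where
  "variable k \<equiv> Poly_Mapping.single (Poly_Mapping.single k 1) 1"

lemma variable_power: "variable k ^ j = Poly_Mapping.single (Poly_Mapping.single k j) 1"
  by (induction j) (simp_all add: mult_single single_add[symmetric])

text \<open>The cofactor no longer involves the variable \<open>k\<close>; collecting terms by the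
  power of that variable reduces \<open>Suc k\<close> variables to \<open>k\<close>.\<close>

lemma monomial_split:
  "Poly_Mapping.single m c = Poly_Mapping.single (Poly_Mapping.update k 0 m) c * variable k ^ Poly_Mapping.lookup m k"
proof -
  have "m = Poly_Mapping.update k 0 m + Poly_Mapping.single k (Poly_Mapping.lookup m k)"
    by (rule poly_mapping_eqI) (auto simp: lookup_add lookup_update lookup_single when_def)
  then show ?thesis unfolding variable_power by (simp add: mult_single)
qed

lemma poly_ring_Suc_generated:
  fixes z :: "(nat \<Rightarrow>\<^sub>0 nat) \<Rightarrow>\<^sub>0 'f::comm_ring_1"
  assumes "z \<in> poly_ring (Suc k)"
  shows "\<exists>f\<in>polys_over (poly_ring k). z = poly f (variable k)"
proof -
  interpret subring_of "poly_ring k :: ((nat \<Rightarrow>\<^sub>0 nat) \<Rightarrow>\<^sub>0 'f) set" by (rule subring_of_poly_ring)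
  let ?t = "\<lambda>m. Poly_Mapping.single (Poly_Mapping.update k 0 m) (Poly_Mapping.lookup z m)"
  let ?f = "\<Sum>m\<in>Poly_Mapping.keys z. monom (?t m) (Poly_Mapping.lookup m k)"
  have "monom (?t m) (Poly_Mapping.lookup m k) \<in> polys_over (poly_ring k)" if "m \<in> Poly_Mapping.keys z" for m
  proof (intro polys_over_monom[OF ideal_self] single_in_poly_ring)
    have "Poly_Mapping.keys m \<subseteq> {..<Suc k}" using assms that unfolding poly_ring_def by blast
    then show "Poly_Mapping.keys (Poly_Mapping.update k 0 m) \<subseteq> {..<k}"
      by (auto simp: keys_update less_Suc_eq)
  qed
  then have mem: "?f \<in> polys_over (poly_ring k)"
    unfolding polys_over_def by (auto simp: coeff_sum intro!: left_ideal_sum[OF ideal_self])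
  have "poly ?f (variable k) = z"
    by (simp only: poly_sum poly_monom monomial_split[symmetric] poly_mapping_sum_single[symmetric])
  from this[symmetric] mem show ?thesis by (rule bexI)
qed

lemma unital_algebra_field: "unital_algebra ((*) :: 'f::field \<Rightarrow> 'f \<Rightarrow> 'f)"
  by unfold_locales (auto simp: algebra_simps intro: exI[of _ 1])

lemma poly_ring_zero_constant: "z \<in> poly_ring 0 \<Longrightarrow> z = Poly_Mapping.single 0 (Poly_Mapping.lookup z 0)"
  by (rule poly_mapping_eqI)
     (auto simp: poly_ring_def lookup_single when_def in_keys_iff)

text \<open>Induction on the number of variables. Without variables the ring is the field itself, so
  \<open>z\<close> is invertible and \<open>p\<close> serves as \<open>m\<close>.\<close>

lemma finitely_separated_poly_ring:
  "finitely_separated (poly_scale (*)) (poly_ring n :: ((nat \<Rightarrow>\<^sub>0 nat) \<Rightarrow>\<^sub>0 'f::field) set) 1"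
proof (induction n)
  case 0
  interpret unital_algebra "(*) :: 'f \<Rightarrow> 'f \<Rightarrow> 'f" by (rule unital_algebra_field)
  interpret V: vector_space "poly_scale ((*) :: 'f \<Rightarrow> 'f \<Rightarrow> 'f)" by (rule vector_space_poly_scale)
  show ?case
    unfolding finitely_separated_def
  proof (intro allI impI)
    fix p and z :: "(nat \<Rightarrow>\<^sub>0 nat) \<Rightarrow>\<^sub>0 'f"
    assume p: "prime_in (poly_ring 0) 1 p" and z: "z \<in> poly_ring 0" "z \<notin> p"
    have pI: "left_ideal (poly_ring 0) p" "1 \<notin> p" using p unfolding prime_in_def by auto
    obtain c where c: "z = Poly_Mapping.single 0 c" using poly_ring_zero_constant[OF z(1)] by blast
    have "c \<noteq> 0" using z(2) left_ideal_zero[OF pI(1)] c by auto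
    then have "Poly_Mapping.single 0 (inverse c) * z - 1 = 0" unfolding c by (simp add: mult_single)
    then have "Poly_Mapping.single 0 (inverse c) * z - 1 \<in> p" using left_ideal_zero[OF pI(1)] by simp
    moreover have "Poly_Mapping.single 0 (inverse c) \<in> poly_ring 0" by (rule single_in_poly_ring) simp
    moreover have "finite_codimension (poly_scale (*)) (poly_ring 0) p"
      unfolding finite_codimension_def
    proof (intro exI[of _ "{1}"] conjI ballI)
      show "{1} \<subseteq> (poly_ring 0 :: ((nat \<Rightarrow>\<^sub>0 nat) \<Rightarrow>\<^sub>0 'f) set)" unfolding poly_ring_def by simp
      fix v :: "(nat \<Rightarrow>\<^sub>0 nat) \<Rightarrow>\<^sub>0 'f" assume "v \<in> poly_ring 0"
      then have "v = Poly_Mapping.single 0 (Poly_Mapping.lookup v 0)" by (rule poly_ring_zero_constant)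
      then have "v = poly_scale (*) (Poly_Mapping.lookup v 0) 1"
        by (metis mult.right_neutral mult_map_scale_conv_mult poly_scale_def)
      then have "v \<in> V.span {1}" using V.span_scale[OF V.span_base[of 1 "{1}"]] by (metis singletonI)
      then show "\<exists>s\<in>V.span {1}. v - s \<in> p" using left_ideal_zero[OF pI(1)] by (intro bexI[of _ v]) auto
    qed simp
    ultimately show "\<exists>m. left_ideal (poly_ring 0) m \<and> p \<subseteq> m \<and> 1 \<notin> m \<and>
        (\<exists>w\<in>poly_ring 0. w * z - 1 \<in> m) \<and> finite_codimension (poly_scale (*)) (poly_ring 0) m"
      using pI by blast
  qed
next
  case (Suc n)
  interpret unital_algebra "(*) :: 'f \<Rightarrow> 'f \<Rightarrow> 'f" by (rule unital_algebra_field)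
  interpret V: vector_space "poly_scale ((*) :: 'f \<Rightarrow> 'f \<Rightarrow> 'f)" by (rule vector_space_poly_scale)
  interpret R: subring_of "poly_ring (Suc n) :: ((nat \<Rightarrow>\<^sub>0 nat) \<Rightarrow>\<^sub>0 'f) set" by (rule subring_of_poly_ring)
  interpret R0: subring_of "poly_ring n :: ((nat \<Rightarrow>\<^sub>0 nat) \<Rightarrow>\<^sub>0 'f) set" by (rule subring_of_poly_ring)
  interpret simple_extension "poly_ring (Suc n)" "poly_ring n" "poly_scale ((*) :: 'f \<Rightarrow> 'f \<Rightarrow> 'f)" "variable n"
  proof
    show "poly_scale (*) c (a * b) = poly_scale (*) c a * b" for c :: 'f and a b
      unfolding poly_scale_def mult_map_scale_conv_mult by (simp add: mult.assoc)
    have "A \<subseteq> {..<Suc n}" if "A \<subseteq> {..<n}" for A using that by auto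
    then show "(poly_ring n :: ((nat \<Rightarrow>\<^sub>0 nat) \<Rightarrow>\<^sub>0 'f) set) \<subseteq> poly_ring (Suc n)"
      unfolding poly_ring_def by auto
    show "variable n \<in> poly_ring (Suc n)" by (rule single_in_poly_ring) auto
  qed (rule poly_ring_Suc_generated)
  show ?case by (rule finitely_separated_extension[OF Suc])
qed

section \<open>The central subring of polynomials with scalar coefficients\<close>

context unital_algebra
begin

definition scalar_embedding ::
    "'a \<Rightarrow> ((nat \<Rightarrow>\<^sub>0 nat) \<Rightarrow>\<^sub>0 'f) \<Rightarrow> ((nat \<Rightarrow>\<^sub>0 nat) \<Rightarrow>\<^sub>0 'a)" where
  "scalar_embedding u = Poly_Mapping.map (\<lambda>c. c *s u)"

lemma lookup_scalar_embedding:
  "Poly_Mapping.lookup (scalar_embedding u q) m = Poly_Mapping.lookup q m *s u"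
  by (simp add: scalar_embedding_def map.rep_eq when_def)

lemma scalar_embedding_zero [simp]: "scalar_embedding u 0 = 0"
  by (rule poly_mapping_eqI) (simp add: lookup_scalar_embedding)

lemma scalar_embedding_single:
  "scalar_embedding u (Poly_Mapping.single m c) = Poly_Mapping.single m (c *s u)"
  by (rule poly_mapping_eqI) (auto simp: lookup_scalar_embedding lookup_single when_def)

lemma scalar_embedding_add: "scalar_embedding u (x + y) = scalar_embedding u x + scalar_embedding u y"
  by (rule poly_mapping_eqI) (simp add: lookup_scalar_embedding lookup_add scale_left_distrib)

lemma scalar_embedding_diff: "scalar_embedding u (x - y) = scalar_embedding u x - scalar_embedding u y"
  by (rule poly_mapping_eqI) (simp add: lookup_scalar_embedding lookup_minus scale_left_diff_distrib)

lemma scalar_embedding_sum: "scalar_embedding u (sum f A) = (\<Sum>i\<in>A. scalar_embedding u (f i))"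
  by (induction A rule: infinite_finite_induct) (auto simp: scalar_embedding_add)

lemma scalar_embedding_scale:
  "scalar_embedding u (poly_scale (*) c x) = poly_scale scale c (scalar_embedding u x)"
  by (rule poly_mapping_eqI)
     (simp add: lookup_scalar_embedding lookup_poly_scale
        unital_algebra.lookup_poly_scale[OF unital_algebra_field])

lemma scalar_embedding_in_poly_ring: "q \<in> poly_ring n \<Longrightarrow> scalar_embedding u q \<in> poly_ring n"
  by (auto simp: poly_ring_def in_keys_iff lookup_scalar_embedding)

lemma scalar_embedding_eq_sum:
  "scalar_embedding u x = (\<Sum>m\<in>Poly_Mapping.keys x. Poly_Mapping.single m (Poly_Mapping.lookup x m *s u))"
  by (subst poly_mapping_sum_single) (simp only: scalar_embedding_sum scalar_embedding_single)

context
  fixes u :: 'a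
  assumes unit: "\<And>x. u * x = x" "\<And>x. x * u = x"
begin

lemma scalar_mult: "(c *s u) * a = c *s a" "a * (c *s u) = c *s a"
  by (simp_all add: unit scale_mult_left[symmetric] scale_mult_right[symmetric])

lemma scalar_embedding_mult: "scalar_embedding u (x * y) = scalar_embedding u x * scalar_embedding u y"
proof -
  let ?s = "\<lambda>x m. Poly_Mapping.single m (Poly_Mapping.lookup x m)"
  have "x * y = (\<Sum>m\<in>Poly_Mapping.keys x. ?s x m) * (\<Sum>k\<in>Poly_Mapping.keys y. ?s y k)"
    by (simp only: poly_mapping_sum_single[symmetric])
  also have "\<dots> = (\<Sum>m\<in>Poly_Mapping.keys x. \<Sum>k\<in>Poly_Mapping.keys y.
      Poly_Mapping.single (m + k) (Poly_Mapping.lookup x m * Poly_Mapping.lookup y k))"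
    by (simp only: sum_product mult_single)
  finally have "scalar_embedding u (x * y) = (\<Sum>m\<in>Poly_Mapping.keys x. \<Sum>k\<in>Poly_Mapping.keys y.
      Poly_Mapping.single (m + k) ((Poly_Mapping.lookup x m * Poly_Mapping.lookup y k) *s u))"
    by (simp only: scalar_embedding_sum scalar_embedding_single)
  also have "\<dots> = scalar_embedding u x * scalar_embedding u y"
    unfolding scalar_embedding_eq_sum sum_product mult_single scalar_mult by (simp add: mult.commute)
  finally show ?thesis .
qed

lemma scalar_embedding_central: "scalar_embedding u x * y = y * scalar_embedding u x"
proof -
  let ?y = "\<Sum>k\<in>Poly_Mapping.keys y. Poly_Mapping.single k (Poly_Mapping.lookup y k)"
  have "scalar_embedding u x * ?y = ?y * scalar_embedding u x"
    unfolding scalar_embedding_eq_sum sum_product mult_single scalar_mult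
    by (subst sum.swap) (simp only: add.commute)
  then show ?thesis by (simp only: poly_mapping_sum_single[symmetric])
qed

lemma scalar_embedding_mult_single:
  "scalar_embedding u x * Poly_Mapping.single 0 a =
    (\<Sum>m\<in>Poly_Mapping.keys x. Poly_Mapping.single m (Poly_Mapping.lookup x m *s a))"
  unfolding scalar_embedding_eq_sum sum_distrib_right mult_single scalar_mult by simp

lemma lookup_scalar_embedding_mult_single:
  "Poly_Mapping.lookup (scalar_embedding u x * Poly_Mapping.single 0 a) m = Poly_Mapping.lookup x m *s a"
  unfolding scalar_embedding_mult_single scalar_embedding_eq_sum[symmetric]
  by (rule lookup_scalar_embedding)

lemma unit_eq: "scalar_embedding u 1 = Poly_Mapping.single 0 u"
  unfolding single_one[symmetric] scalar_embedding_single by simp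

lemma unit_poly: "Poly_Mapping.single 0 u * x = x" "x * Poly_Mapping.single 0 u = x"
proof -
  let ?x = "\<Sum>k\<in>Poly_Mapping.keys x. Poly_Mapping.single k (Poly_Mapping.lookup x k)"
  have "Poly_Mapping.single 0 u * ?x = ?x" "?x * Poly_Mapping.single 0 u = ?x"
    by (simp_all add: sum_distrib_left sum_distrib_right mult_single unit)
  then show "Poly_Mapping.single 0 u * x = x" "x * Poly_Mapping.single 0 u = x"
    by (simp_all only: poly_mapping_sum_single[symmetric])
qed

text \<open>Primes are pulled back along the homomorphism and ideals pushed forward. The kernel lies
  in every prime obtained by pulling back, hence in \<open>m\<close>; this keeps the image of
  \<open>m\<close> proper without injectivity.\<close>

lemma finitely_separated_scalars:
  "finitely_separated (poly_scale scale) (scalar_embedding u ` poly_ring n) (Poly_Mapping.single 0 u)"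
  unfolding finitely_separated_def
proof (intro allI impI)
  let ?h = "scalar_embedding u" and ?R = "poly_ring n :: ((nat \<Rightarrow>\<^sub>0 nat) \<Rightarrow>\<^sub>0 'f) set"
    and ?u = "Poly_Mapping.single 0 u :: (nat \<Rightarrow>\<^sub>0 nat) \<Rightarrow>\<^sub>0 'a"
  interpret R: subring_of ?R by (rule subring_of_poly_ring)
  interpret V: vector_space "poly_scale ((*) :: 'f \<Rightarrow> 'f \<Rightarrow> 'f)"
    by (rule unital_algebra.vector_space_poly_scale[OF unital_algebra_field])
  interpret W: vector_space "poly_scale scale" by (rule vector_space_poly_scale)
  fix P z assume P: "prime_in (?h ` ?R) ?u P" and z: "z \<in> ?h ` ?R" "z \<notin> P"
  have PI: "left_ideal (?h ` ?R) P" and uP: "?u \<notin> P"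
    and prime: "\<And>x y. x \<in> ?R \<Longrightarrow> y \<in> ?R \<Longrightarrow> ?h x * ?h y \<in> P \<Longrightarrow> ?h x \<in> P \<or> ?h y \<in> P"
    using P unfolding prime_in_def by auto
  define p where "p = {x \<in> ?R. ?h x \<in> P}"
  have "prime_in ?R 1 p"
    unfolding prime_in_def
  proof (intro conjI ballI impI)
    show "left_ideal ?R p"
      unfolding left_ideal_def p_def
      using R.zero_closed R.diff_closed R.mult_closed left_ideal_zero[OF PI] left_ideal_diff[OF PI]
        left_ideal_mult[OF PI]
      by (auto simp: scalar_embedding_diff scalar_embedding_mult)
    show "1 \<notin> p" unfolding p_def using uP by (simp add: unit_eq)
    fix x y assume "x \<in> ?R" "y \<in> ?R" "x * y \<in> p"
    then show "x \<in> p \<or> y \<in> p" unfolding p_def using prime by (auto simp: scalar_embedding_mult)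
  qed
  moreover obtain x where x: "x \<in> ?R" "z = ?h x" using z by blast
  moreover have "x \<notin> p" using x z unfolding p_def by simp
  ultimately obtain m w where m: "left_ideal ?R m" "p \<subseteq> m" "1 \<notin> m" "w \<in> ?R" "w * x - 1 \<in> m"
      "finite_codimension (poly_scale (*)) ?R m"
    using finitely_separated_poly_ring[of n] unfolding finitely_separated_def by blast
  obtain S where S: "finite S" "S \<subseteq> ?R" "\<forall>v\<in>?R. \<exists>s\<in>V.span S. v - s \<in> m"
    using m(6) unfolding finite_codimension_def by blast
  have span: "?h s \<in> W.span (?h ` S)" if "s \<in> V.span S" for s
    using that
  proof (induction rule: V.span_induct_alt)
    case base
    then show ?case by (simp add: W.span_zero)
  next
    case (step c x y)
    have "?h x \<in> W.span (?h ` S)" using step(1) by (intro W.span_base imageI)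
    from W.span_add[OF W.span_scale[OF this] step(2)] show ?case
      unfolding scalar_embedding_add scalar_embedding_scale .
  qed
  have "left_ideal (?h ` ?R) (?h ` m)"
    unfolding left_ideal_def
  proof (intro conjI ballI)
    show "?h ` m \<subseteq> ?h ` ?R" using left_ideal_subset[OF m(1)] by blast
    show "0 \<in> ?h ` m" using left_ideal_zero[OF m(1)] by (intro image_eqI[of _ _ 0]) auto
    show "a - b \<in> ?h ` m" if "a \<in> ?h ` m" "b \<in> ?h ` m" for a b
      using that left_ideal_diff[OF m(1)] by (auto simp: scalar_embedding_diff[symmetric])
    show "a * b \<in> ?h ` m" if "a \<in> ?h ` ?R" "b \<in> ?h ` m" for a b
      using that left_ideal_mult[OF m(1)] by (auto simp: scalar_embedding_mult[symmetric])
  qed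
  moreover have "P \<subseteq> ?h ` m" using left_ideal_subset[OF PI] m(2) unfolding p_def by blast
  moreover have "?u \<notin> ?h ` m"
  proof
    assume "?u \<in> ?h ` m"
    then obtain y where y: "y \<in> m" "?h y = ?h 1" unfolding unit_eq by auto
    have "?h (1 - y) = 0" using y(2) by (simp add: scalar_embedding_diff)
    moreover have "1 - y \<in> ?R"
      using y(1) left_ideal_subset[OF m(1)] by (intro R.diff_closed R.one_closed) blast
    ultimately have "1 - y \<in> m" using m(2) left_ideal_zero[OF PI] unfolding p_def by auto
    then show False using left_ideal_cong[OF m(1), of 1 y] y(1) m(3) by simp
  qed
  moreover have "?h w * z - ?u \<in> ?h ` m"
    unfolding x(2) unit_eq[symmetric] scalar_embedding_mult[symmetric] scalar_embedding_diff[symmetric]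
    using m(5) by (rule imageI)
  moreover have "finite_codimension (poly_scale scale) (?h ` ?R) (?h ` m)"
    unfolding finite_codimension_def
  proof (intro exI[of _ "?h ` S"] conjI ballI)
    show "finite (?h ` S)" "?h ` S \<subseteq> ?h ` ?R" using S by auto
    fix v assume "v \<in> ?h ` ?R"
    then obtain x where x: "x \<in> ?R" "v = ?h x" by blast
    then obtain s where s: "s \<in> V.span S" "x - s \<in> m" using S by blast
    have "v - ?h s \<in> ?h ` m"
      unfolding x(2) scalar_embedding_diff[symmetric] using s(2) by (rule imageI)
    then show "\<exists>s\<in>W.span (?h ` S). v - s \<in> ?h ` m" using span[OF s(1)] by blast
  qed
  ultimately show "\<exists>m. left_ideal (?h ` ?R) m \<and> P \<subseteq> m \<and> ?u \<notin> m \<and>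
      (\<exists>w\<in>?h ` ?R. w * z - ?u \<in> m) \<and> finite_codimension (poly_scale scale) (?h ` ?R) m"
    using m(4) by blast
qed

text \<open>Scaling by \<open>c\<close> is left multiplication by the constant polynomial
  \<open>c *s u\<close>, so this is associativity.\<close>

lemma poly_scale_mult: "poly_scale scale c (x * y) = poly_scale scale c x * y"
proof -
  interpret W: vector_space "poly_scale scale" by (rule vector_space_poly_scale)
  have single: "poly_scale scale c (Poly_Mapping.single k a) = Poly_Mapping.single k (c *s a)" for k a
    by (rule poly_mapping_eqI) (simp add: lookup_poly_scale lookup_single when_def)
  have eq: "poly_scale scale c x = Poly_Mapping.single 0 (c *s u) * x" for x
  proof -
    let ?x = "\<Sum>k\<in>Poly_Mapping.keys x. Poly_Mapping.single k (Poly_Mapping.lookup x k)"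
    have "poly_scale scale c ?x = Poly_Mapping.single 0 (c *s u) * ?x"
      by (simp add: W.scale_sum_right single sum_distrib_left mult_single scalar_mult)
    then show ?thesis by (simp only: poly_mapping_sum_single[symmetric])
  qed
  show ?thesis unfolding eq by (simp add: mult.assoc)
qed

lemma finite_over_center_poly_ring:
  assumes bs: "distinct bs" "independent (set bs)" "span (set bs) = UNIV"
  shows "finite_over_center (poly_ring n) (scalar_embedding u ` poly_ring n) (Poly_Mapping.single 0 u)
    (\<lambda>i. Poly_Mapping.single 0 (bs ! i)) (length bs)"
proof
  let ?h = "scalar_embedding u" and ?R = "poly_ring n :: ((nat \<Rightarrow>\<^sub>0 nat) \<Rightarrow>\<^sub>0 'f) set"
  interpret R: subring_of ?R by (rule subring_of_poly_ring)
  show "x - y \<in> ?h ` ?R" if "x \<in> ?h ` ?R" "y \<in> ?h ` ?R" for x y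
    using that R.diff_closed by (auto simp: scalar_embedding_diff[symmetric])
  show "x * y \<in> ?h ` ?R" if "x \<in> ?h ` ?R" "y \<in> ?h ` ?R" for x y
    using that R.mult_closed by (auto simp: scalar_embedding_mult[symmetric])
  show "?h ` ?R \<subseteq> poly_ring n" using scalar_embedding_in_poly_ring by blast
  show "Poly_Mapping.single 0 u \<in> ?h ` ?R" using R.one_closed by (auto simp: unit_eq[symmetric])
  show "z * x = x * z" if "z \<in> ?h ` ?R" for z x using that scalar_embedding_central by auto
  show "Poly_Mapping.single 0 (bs ! i) \<in> poly_ring n" for i by (rule single_in_poly_ring) simp
  show "\<exists>z. (\<forall>i<length bs. z i \<in> ?h ` ?R) \<and> x = (\<Sum>i<length bs. z i * Poly_Mapping.single 0 (bs ! i))"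
    if x: "x \<in> poly_ring n" for x
  proof -
    \<comment> \<open>\<open>q i\<close> collects the \<open>i\<close>-th coordinates of all
      coefficients of \<open>x\<close> with respect to the basis; since zero has zero coordinates,
      no new monomials arise.\<close>
    define q where "q i = Poly_Mapping.map (\<lambda>a. representation (set bs) a (bs ! i)) x" for i
    have lq: "Poly_Mapping.lookup (q i) m = representation (set bs) (Poly_Mapping.lookup x m) (bs ! i)" for i m
      unfolding q_def by (simp add: map.rep_eq when_def representation_zero)
    have "q i \<in> ?R" for i
      using x unfolding poly_ring_def by (auto simp: in_keys_iff lq representation_zero)
    moreover have "x = (\<Sum>i<length bs. ?h (q i) * Poly_Mapping.single 0 (bs ! i))"
    proof (rule poly_mapping_eqI)
      fix m
      let ?a = "Poly_Mapping.lookup x m"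
      have "Poly_Mapping.lookup (\<Sum>i<length bs. ?h (q i) * Poly_Mapping.single 0 (bs ! i)) m =
          (\<Sum>i<length bs. representation (set bs) ?a (bs ! i) *s (bs ! i))"
        by (simp add: lookup_sum lookup_scalar_embedding_mult_single lq)
      also have "\<dots> = (\<Sum>b\<in>set bs. representation (set bs) ?a b *s b)"
        by (rule sum.reindex_bij_betw[OF bij_betw_nth[OF bs(1) refl refl]])
      also have "\<dots> = ?a" using sum_representation_eq[OF bs(2), of ?a "set bs"] bs(3) by simp
      finally show "?a = Poly_Mapping.lookup (\<Sum>i<length bs. ?h (q i) * Poly_Mapping.single 0 (bs ! i)) m" ..
    qed
    ultimately show ?thesis by (intro exI[of _ "\<lambda>i. ?h (q i)"]) blast
  qed
qed (auto intro: diff_in_poly_ring mult_in_poly_ring simp: unit_poly)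

end

end

theorem theorem30:
  fixes scale :: "'f::field \<Rightarrow> 'a::ring \<Rightarrow> 'a"
    and n :: nat
  assumes "finite_dimensional_algebra scale"
  shows "strongly_left_Jacobson (poly_ring n :: ((nat \<Rightarrow>\<^sub>0 nat) \<Rightarrow>\<^sub>0 'a) set) \<and>
    (\<forall>M :: ((nat \<Rightarrow>\<^sub>0 nat) \<Rightarrow>\<^sub>0 'a) set. maximal_left_ideal (poly_ring n) M \<longrightarrow>
      finite_codimension (poly_scale scale) (poly_ring n) M)"
proof -
  interpret A: finite_dimensional_algebra scale by (rule assms)
  obtain u :: 'a where u: "\<And>x. u * x = x" "\<And>x. x * u = x" using A.ex_unit by metis
  obtain Basis where "finite_dimensional_vector_space scale Basis" using A.finite_dimensional by blast
  then interpret F: finite_dimensional_vector_space scale Basis .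
  obtain bs where bs: "set bs = Basis" "distinct bs"
    using finite_distinct_list[OF F.finite_Basis] by blast
  interpret finite_over_center "poly_ring n" "A.scalar_embedding u ` poly_ring n" "Poly_Mapping.single 0 u"
      "\<lambda>i. Poly_Mapping.single 0 (bs ! i)" "length bs"
    by (rule A.finite_over_center_poly_ring[OF u bs(2)])
       (simp_all add: bs F.independent_Basis F.span_Basis)
  have sep: "finitely_separated (poly_scale scale) (A.scalar_embedding u ` poly_ring n) (Poly_Mapping.single 0 u)"
    by (rule A.finitely_separated_scalars[OF u])
  show ?thesis
    by (intro conjI allI impI strongly_left_Jacobson_if_separated[OF sep]
        finite_codimension_maximal[OF A.vector_space_poly_scale A.poly_scale_mult[OF u] sep])
qed

end
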